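(* Let $B=k[X_1,\ldots,X_n]/I=k[x_1,\ldots,x_n]$ be a finitely generated $k$-domain, and let $\partial$ be a locally nilpotent $k$-derivation of $B$ whose kernel is a finitely generated $k$-algebra, with data $z_1,\ldots,z_r$, $s_1,\ldots,s_m$, $d_1,\ldots,d_n$, $\mathcal G$, $J$, $\omega$ and $\hat J$ as described in the context. Then the $\mathbb N$-filtration $\mathcal G$ of $B$ is proper if and only if the ideal $\hat J\subset k^{[r+n+m]}$ is prime.
   Context: $k$ is a field of characteristic zero; $\mathbb N=\mathbb Z_{\ge 0}$; $k^{[N]}$ is the polynomial ring in $N$ variables over $k$. A $k$-derivation $\partial$ of $B$ is locally nilpotent if every $a\in B$ satisfies $\partial^n(a)=0$ for some $n\ge 0$; $\deg_\partial(a):=\min\{i\in\mathbb N\mid\partial^{i+1}(a)=0\}$ for $a\neq 0$, $\deg_\partial(0)=-\infty$. The $\partial$-filtration is $\mathcal F_i=\ker\partial^{i+1}$. An $\mathbb N$-filtration of $B$ is a family $\{\mathcal G_i\}_{i\in\mathbb N}$ of $k$-subspaces with $\mathcal G_i\subset\mathcal G_{i+1}$, $B=\bigcup_i\mathcal G_i$, $\mathcal G_i\mathcal G_j\subset\mathcal G_{i+j}$; it is proper if moreover $a\in\mathcal G_i\setminus\mathcal G_{i-1}$, $b\in\mathcal G_j\setminus\mathcal G_{j-1}$ imply $ab\in\mathcal G_{i+j}\setminus\mathcal G_{i+j-1}$ (with $\mathcal G_{-1}=0$). Data. It is assumed that the origin lies in $\mathrm{Spec}(B)$, that is, $I\subset(X_1,\ldots,X_n)$.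 The algebra $\ker\partial=\mathcal F_0$ is generated by $z_1,\ldots,z_r\in B$ with $z_j(0,\ldots,0)=0$. The elements $s_1,\ldots,s_m\in\mathcal F_1$ are irreducible, satisfy $s_i(0,\ldots,0)=0$, $\deg_\partial(s_i)=1$, and $\mathcal F_1=\mathcal F_0s_1+\cdots+\mathcal F_0s_m+\mathcal F_0$, the elements $\partial(s_1),\ldots,\partial(s_m)$ being generators of the plinth ideal $\ker\partial\cap\partial(B)$ of $\ker\partial$. Put $d_i=\deg_\partial(x_i)$. The filtration $\mathcal G$ is $\mathcal G_i=\sum_{j\le i}H_j$ with $$H_j=\sum_{\sum_l u_l+\sum_i d_iv_i=j}\mathcal F_0\,\bigl(s_1^{u_1}\cdots s_m^{u_m}x_1^{v_1}\cdots x_n^{v_n}\bigr),\quad u_l,v_i\in\mathbb N.$$ Choosing polynomials $z_j(X_1,\ldots,X_n)$, $s_i(X_1,\ldots,X_n)$ representing $z_j$, $s_i$, the ideal $J\subset k^{[r+n+m]}=k[Z_1,\ldots,Z_r][X_1,\ldots,X_n][S_1,\ldots,S_m]$ is generated by $I$, the elements $Z_j-z_j(X_1,\ldots,X_n)$ ($1\le j\le r$) and $S_i-s_i(X_1,\ldots,X_n)$ ($1\le i\le m$), so that $B\simeq k^{[r+n+m]}/J$. The $\mathbb N$-weight degree function $\omega$ on $k^{[r+n+m]}$ is defined by the weights $\omega(Z_i)=0$, $\omega(S_i)=1$, $\omega(X_i)=d_i$. The ideal $\hat J$ is the homogeneous ideal generated by the highest homogeneous components, relative to $\omega$, of all elements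 of $J$. *)

theory Defs
  imports "HOL-Algebra.Algebra" "HOL-Library.Poly_Mapping" "HOL-Library.Extended"
begin

section \<open>Polynomial rings\<close>

text \<open>The three families of variables, each with indices starting at 1.\<close>

datatype gen = ZVar nat | XVar nat | SVar nat

type_synonym 'k mpoly = "(gen \<Rightarrow>\<^sub>0 nat) \<Rightarrow>\<^sub>0 'k"

definition Const :: "'k::comm_ring_1 \<Rightarrow> 'k mpoly" where
  "Const c = Poly_Mapping.single 0 c"

definition Var :: "gen \<Rightarrow> 'k::comm_ring_1 mpoly" where
  "Var v = Poly_Mapping.single (Poly_Mapping.single v 1) 1"

text \<open>The polynomial ring in the variables \<open>V\<close>, so that for \<open>V \<subseteq> W\<close> the ring in \<open>V\<close> is
  literally a subring of the ring in \<open>W\<close>.\<close>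

definition mpoly_ring :: "gen set \<Rightarrow> 'k::comm_ring_1 mpoly ring" where
  "mpoly_ring V =
     \<lparr>carrier = {p. \<forall>t\<in>Poly_Mapping.keys p. Poly_Mapping.keys t \<subseteq> V},
      monoid.mult = (*), one = 1, ring.zero = 0, ring.add = (+)\<rparr>"

text \<open>The value at the origin is the coefficient of the monomial \<open>1\<close>.\<close>

definition eval_origin :: "'k::comm_ring_1 mpoly \<Rightarrow> 'k" where
  "eval_origin p = Poly_Mapping.lookup p 0"

section \<open>Weight degree functions and highest homogeneous components\<close>

definition mono_weight :: "(gen \<Rightarrow> nat) \<Rightarrow> (gen \<Rightarrow>\<^sub>0 nat) \<Rightarrow> nat" where
  "mono_weight w t = (\<Sum>v\<in>Poly_Mapping.keys t. w v * Poly_Mapping.lookup t v)"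

definition weight_deg :: "(gen \<Rightarrow> nat) \<Rightarrow> 'k::comm_ring_1 mpoly \<Rightarrow> nat extended" where
  "weight_deg w p =
     (if p = 0 then -\<infinity> else Fin (Max (mono_weight w ` Poly_Mapping.keys p)))"

definition top_component :: "(gen \<Rightarrow> nat) \<Rightarrow> 'k::comm_ring_1 mpoly \<Rightarrow> 'k mpoly" where
  "top_component w p =
     (\<Sum>t | t \<in> Poly_Mapping.keys p \<and> Fin (mono_weight w t) = weight_deg w p.
        Poly_Mapping.single t (Poly_Mapping.lookup p t))"

section \<open>Locally nilpotent derivations\<close>

text \<open>Here \<open>K\<close> is the image of the ground field in the ring \<open>B\<close>.\<close>

definition derivation_over :: "'b set \<Rightarrow> ('b, 'c) ring_scheme \<Rightarrow> ('b \<Rightarrow> 'b) \<Rightarrow> bool" where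
  "derivation_over K B D \<longleftrightarrow>
     D \<in> carrier B \<rightarrow> carrier B \<and>
     (\<forall>a\<in>carrier B. \<forall>b\<in>carrier B. D (a \<oplus>\<^bsub>B\<^esub> b) = D a \<oplus>\<^bsub>B\<^esub> D b) \<and>
     (\<forall>c\<in>K. \<forall>a\<in>carrier B. D (c \<otimes>\<^bsub>B\<^esub> a) = c \<otimes>\<^bsub>B\<^esub> D a) \<and>
     (\<forall>a\<in>carrier B. \<forall>b\<in>carrier B.
        D (a \<otimes>\<^bsub>B\<^esub> b) = D a \<otimes>\<^bsub>B\<^esub> b \<oplus>\<^bsub>B\<^esub> a \<otimes>\<^bsub>B\<^esub> D b)"

definition locally_nilpotent :: "('b, 'c) ring_scheme \<Rightarrow> ('b \<Rightarrow> 'b) \<Rightarrow> bool" where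
  "locally_nilpotent B D \<longleftrightarrow> (\<forall>a\<in>carrier B. \<exists>n. (D ^^ n) a = \<zero>\<^bsub>B\<^esub>)"

definition lnd_deg :: "('b, 'c) ring_scheme \<Rightarrow> ('b \<Rightarrow> 'b) \<Rightarrow> 'b \<Rightarrow> nat extended" where
  "lnd_deg B D a =
     (if a = \<zero>\<^bsub>B\<^esub> then -\<infinity> else Fin (LEAST i. (D ^^ (i + 1)) a = \<zero>\<^bsub>B\<^esub>))"

definition lnd_filtration :: "('b, 'c) ring_scheme \<Rightarrow> ('b \<Rightarrow> 'b) \<Rightarrow> nat \<Rightarrow> 'b set" where
  "lnd_filtration B D i = {a \<in> carrier B. (D ^^ (i + 1)) a = \<zero>\<^bsub>B\<^esub>}"

definition plinth :: "('b, 'c) ring_scheme \<Rightarrow> ('b \<Rightarrow> 'b) \<Rightarrow> 'b set" where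
  "plinth B D = {a \<in> carrier B. D a = \<zero>\<^bsub>B\<^esub>} \<inter> D ` carrier B"

section \<open>Filtrations\<close>

text \<open>The library predicate \<open>subalgebra K V B\<close> says that \<open>V\<close> is an additive subgroup of \<open>B\<close>
  stable under multiplication by \<open>K\<close>, that is, a \<open>K\<close>-subspace; it does not ask for closure
  under products.\<close>

definition N_filtration :: "'b set \<Rightarrow> ('b, 'c) ring_scheme \<Rightarrow> (nat \<Rightarrow> 'b set) \<Rightarrow> bool" where
  "N_filtration K B G \<longleftrightarrow>
     (\<forall>i. subalgebra K (G i) B) \<and>
     (\<forall>i. G i \<subseteq> G (i + 1)) \<and>
     carrier B = (\<Union>i. G i) \<and>
     (\<forall>i j. \<forall>a\<in>G i. \<forall>b\<in>G j. a \<otimes>\<^bsub>B\<^esub> b \<in> G (i + j))"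

text \<open>The difference of the pieces of index \<open>i\<close> and \<open>i - 1\<close>, with the zero subspace as the piece of
  index \<open>-1\<close>.\<close>

definition layer :: "('b, 'c) ring_scheme \<Rightarrow> (nat \<Rightarrow> 'b set) \<Rightarrow> nat \<Rightarrow> 'b set" where
  "layer B G i = G i - (if i = 0 then {\<zero>\<^bsub>B\<^esub>} else G (i - 1))"

definition proper_N_filtration :: "'b set \<Rightarrow> ('b, 'c) ring_scheme \<Rightarrow> (nat \<Rightarrow> 'b set) \<Rightarrow> bool" where
  "proper_N_filtration K B G \<longleftrightarrow>
     N_filtration K B G \<and>
     (\<forall>i j. \<forall>a\<in>layer B G i. \<forall>b\<in>layer B G j. a \<otimes>\<^bsub>B\<^esub> b \<in> layer B G (i + j))"

text \<open>The sum of the submodules \<open>A g\<close> of \<open>B\<close>, where \<open>A\<close> is a subring and \<open>g\<close> runs through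
  the possibly infinite set \<open>E\<close>.\<close>

definition lin_span :: "('b, 'c) ring_scheme \<Rightarrow> 'b set \<Rightarrow> 'b set \<Rightarrow> 'b set" where
  "lin_span B A E =
     {(\<Oplus>\<^bsub>B\<^esub>g\<in>F. c g \<otimes>\<^bsub>B\<^esub> g) | F c. finite F \<and> F \<subseteq> E \<and> c \<in> F \<rightarrow> A}"

definition weighted_monomials ::
    "('b, 'c) ring_scheme \<Rightarrow> nat \<Rightarrow> (nat \<Rightarrow> 'b) \<Rightarrow> nat \<Rightarrow> (nat \<Rightarrow> 'b) \<Rightarrow> (nat \<Rightarrow> nat) \<Rightarrow> nat \<Rightarrow> 'b set" where
  "weighted_monomials B m s n x d j =
     {(\<Otimes>\<^bsub>B\<^esub>l\<in>{1..m}. s l [^]\<^bsub>B\<^esub> u l) \<otimes>\<^bsub>B\<^esub> (\<Otimes>\<^bsub>B\<^esub>i\<in>{1..n}. x i [^]\<^bsub>B\<^esub> v i) | u v.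
        (\<Sum>l\<in>{1..m}. u l) + (\<Sum>i\<in>{1..n}. d i * v i) = (j::nat)}"

definition piece_H ::
    "('b, 'c) ring_scheme \<Rightarrow> 'b set \<Rightarrow> nat \<Rightarrow> (nat \<Rightarrow> 'b) \<Rightarrow> nat \<Rightarrow> (nat \<Rightarrow> 'b) \<Rightarrow> (nat \<Rightarrow> nat) \<Rightarrow> nat \<Rightarrow> 'b set" where
  "piece_H B A m s n x d j = lin_span B A (weighted_monomials B m s n x d j)"

definition filtration_G ::
    "('b, 'c) ring_scheme \<Rightarrow> 'b set \<Rightarrow> nat \<Rightarrow> (nat \<Rightarrow> 'b) \<Rightarrow> nat \<Rightarrow> (nat \<Rightarrow> 'b) \<Rightarrow> (nat \<Rightarrow> nat) \<Rightarrow> nat \<Rightarrow> 'b set" where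
  "filtration_G B A m s n x d i =
     {(\<Oplus>\<^bsub>B\<^esub>j\<in>{..i}. h j) | h. \<forall>j\<le>i. h j \<in> piece_H B A m s n x d j}"

section \<open>The ideals of the extended presentation\<close>

definition all_vars :: "nat \<Rightarrow> nat \<Rightarrow> nat \<Rightarrow> gen set" where
  "all_vars r n m = ZVar ` {1..r} \<union> XVar ` {1..n} \<union> SVar ` {1..m}"

fun omega :: "(nat \<Rightarrow> nat) \<Rightarrow> gen \<Rightarrow> nat" where
  "omega d (ZVar j) = 0"
| "omega d (XVar i) = d i"
| "omega d (SVar l) = 1"

definition ideal_J ::
    "'k::comm_ring_1 mpoly set \<Rightarrow> nat \<Rightarrow> (nat \<Rightarrow> 'k mpoly) \<Rightarrow> nat \<Rightarrow> nat \<Rightarrow> (nat \<Rightarrow> 'k mpoly) \<Rightarrow> 'k mpoly set" where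
  "ideal_J I r zp n m sp =
     Idl\<^bsub>mpoly_ring (all_vars r n m)\<^esub>
       (I \<union> {Var (ZVar j) - zp j | j. j \<in> {1..r}} \<union> {Var (SVar l) - sp l | l. l \<in> {1..m}})"

definition top_ideal :: "(gen \<Rightarrow> nat) \<Rightarrow> gen set \<Rightarrow> 'k::comm_ring_1 mpoly set \<Rightarrow> 'k mpoly set" where
  "top_ideal w V J = Idl\<^bsub>mpoly_ring V\<^esub> (top_component w ` J)"

end

theory Submission
  imports Defs
begin

text \<open>
  Write \<open>P\<close> for the polynomial ring in the variables \<open>Z\<close>, \<open>X\<close>, \<open>S\<close>, graded by the weights, and
  \<open>\<phi> : P \<rightarrow> B\<close> for the homomorphism that sends every variable to the element of \<open>B\<close> which it stands
  for. Two facts reduce the claim to a statement about \<open>\<phi>\<close>. The kernel of \<open>\<phi>\<close> is \<open>J\<close>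
  (\<open>ideal_J_eq_kernel\<close>), because the generators of \<open>J\<close> allow every variable \<open>Z\<close> or \<open>S\<close> to be replaced
  by the polynomial in \<open>X\<close> representing it. And the \<open>i\<close>-th piece of the filtration is the image of
  the polynomials of weight at most \<open>i\<close> (\<open>filtration_G_eq\<close>): the kernel of the derivation is the
  image of the polynomials in the \<open>Z\<close> alone, which have weight \<open>0\<close>, and hence the homogeneous
  polynomials of weight \<open>j\<close> are mapped onto the \<open>j\<close>-th summand (\<open>piece_H_eq\<close>).

  For such an image filtration the associated graded ring is \<open>P\<close> modulo the ideal of highest
  components of \<open>J\<close>, and the filtration is proper if and only if the graded ring is a domain. The
  proof unwinds this without forming the graded ring. A polynomial is said to fall below \<open>i\<close> if its
  image is also the image of a polynomial with all weights less than \<open>i\<close>; thus for a homogeneous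
  polynomial of weight \<open>i\<close> this says that its class in the graded ring vanishes. The polynomials all of
  whose homogeneous components fall below their weight form the ideal of highest components
  (\<open>top_ideal_kernel_eq_falling_ideal\<close>), and properness says that if \<open>p\<close>, \<open>q\<close> have weights at most
  \<open>i\<close>, \<open>j\<close> and do not fall below \<open>i\<close>, \<open>j\<close>, then \<open>p q\<close> does not fall below \<open>i + j\<close> (\<open>proper_iff\<close>).
  Passing between polynomials and suitable homogeneous components identifies this with primality
  (\<open>proper_iff_primeideal\<close>).
\<close>

section \<open>Rings of polynomials in a set of variables\<close>

lemma mpoly_ring_simps [simp]:
  "x \<otimes>\<^bsub>mpoly_ring V\<^esub> y = x * y" "x \<oplus>\<^bsub>mpoly_ring V\<^esub> y = x + y"
  "\<one>\<^bsub>mpoly_ring V\<^esub> = 1" "\<zero>\<^bsub>mpoly_ring V\<^esub> = 0"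
  by (simp_all add: mpoly_ring_def)

lemma in_mpoly_ring:
  "p \<in> carrier (mpoly_ring V) \<longleftrightarrow> (\<forall>t\<in>Poly_Mapping.keys p. Poly_Mapping.keys t \<subseteq> V)"
  by (simp add: mpoly_ring_def)

lemma mpoly_ring_mono: "V \<subseteq> W \<Longrightarrow> carrier (mpoly_ring V) \<subseteq> carrier (mpoly_ring W)"
  by (fastforce simp: in_mpoly_ring)

lemma mpoly_ring_zero: "0 \<in> carrier (mpoly_ring V)"
  by (simp add: in_mpoly_ring)

lemma mpoly_ring_Const: "Const c \<in> carrier (mpoly_ring V)"
  by (simp add: in_mpoly_ring Const_def)

lemma mpoly_ring_Var: "v \<in> V \<Longrightarrow> Var v \<in> carrier (mpoly_ring V)"
  by (simp add: in_mpoly_ring Var_def)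

lemma mpoly_ring_add:
  "p \<in> carrier (mpoly_ring V) \<Longrightarrow> q \<in> carrier (mpoly_ring V) \<Longrightarrow> p + q \<in> carrier (mpoly_ring V)"
  using Poly_Mapping.keys_add[of p q] by (auto simp: in_mpoly_ring)

lemma mpoly_ring_uminus: "p \<in> carrier (mpoly_ring V) \<Longrightarrow> - p \<in> carrier (mpoly_ring V)"
  by (simp add: in_mpoly_ring)

lemma mpoly_ring_diff:
  "p \<in> carrier (mpoly_ring V) \<Longrightarrow> q \<in> carrier (mpoly_ring V) \<Longrightarrow> p - q \<in> carrier (mpoly_ring V)"
  using mpoly_ring_add[of p V "- q"] mpoly_ring_uminus[of q V] by simp

lemma keys_add_nat:
  fixes s t :: "'a \<Rightarrow>\<^sub>0 nat"
  shows "Poly_Mapping.keys (s + t) = Poly_Mapping.keys s \<union> Poly_Mapping.keys t"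
  by (auto simp: in_keys_iff lookup_add)

lemma mpoly_ring_mult:
  "p \<in> carrier (mpoly_ring V) \<Longrightarrow> q \<in> carrier (mpoly_ring V) \<Longrightarrow> p * q \<in> carrier (mpoly_ring V)"
  using keys_mult[of p q] by (fastforce simp: in_mpoly_ring keys_add_nat)

lemma cring_mpoly_ring: "cring (mpoly_ring V :: 'k::comm_ring_1 mpoly ring)"
proof (rule cringI)
  let ?M = "mpoly_ring V :: 'k mpoly ring"
  show "abelian_group ?M"
  proof (rule abelian_groupI)
    fix p assume "p \<in> carrier ?M"
    then show "\<exists>q\<in>carrier ?M. q \<oplus>\<^bsub>?M\<^esub> p = \<zero>\<^bsub>?M\<^esub>"
      by (intro bexI[of _ "- p"]) (auto intro: mpoly_ring_uminus)
  qed (auto simp: algebra_simps mpoly_ring_zero mpoly_ring_add)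
  show "Group.comm_monoid ?M"
    by (rule comm_monoidI)
      (use mpoly_ring_Const[of 1 V] in \<open>auto simp: algebra_simps mpoly_ring_mult Const_def\<close>)
qed (auto simp: algebra_simps)

lemma mpoly_ring_one: "1 \<in> carrier (mpoly_ring V)"
  using cring.cring_simprules(6)[OF cring_mpoly_ring, of V] by simp

lemma mpoly_ring_a_inv:
  assumes "p \<in> carrier (mpoly_ring V)"
  shows "\<ominus>\<^bsub>mpoly_ring V\<^esub> p = - p"
proof -
  interpret cring "mpoly_ring V" by (rule cring_mpoly_ring)
  show ?thesis
    using minus_equality[of "- p" p] assms mpoly_ring_uminus[OF assms] by simp
qed

lemma mpoly_ring_sum:
  "(\<And>a. a \<in> A \<Longrightarrow> f a \<in> carrier (mpoly_ring V)) \<Longrightarrow> sum f A \<in> carrier (mpoly_ring V)"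
  by (induction A rule: infinite_finite_induct) (auto simp: mpoly_ring_zero mpoly_ring_add)

lemma mpoly_ring_power:
  "p \<in> carrier (mpoly_ring V) \<Longrightarrow> p ^ e \<in> carrier (mpoly_ring V)"
  by (induction e) (auto simp: mpoly_ring_one mpoly_ring_mult)

lemma mpoly_ring_prod:
  "(\<And>a. a \<in> A \<Longrightarrow> f a \<in> carrier (mpoly_ring V)) \<Longrightarrow> prod f A \<in> carrier (mpoly_ring V)"
  by (induction A rule: infinite_finite_induct) (auto simp: mpoly_ring_one mpoly_ring_mult)

lemma mpoly_ring_single:
  "Poly_Mapping.keys t \<subseteq> V \<Longrightarrow> Poly_Mapping.single t c \<in> carrier (mpoly_ring V)"
  by (simp add: in_mpoly_ring)

lemma sum_monomials:
  "p = (\<Sum>t\<in>Poly_Mapping.keys p. Poly_Mapping.single t (Poly_Mapping.lookup p t))"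
proof (rule poly_mapping_eqI)
  fix u
  show "Poly_Mapping.lookup p u = Poly_Mapping.lookup
     (\<Sum>t\<in>Poly_Mapping.keys p. Poly_Mapping.single t (Poly_Mapping.lookup p t)) u"
    by (simp add: lookup_sum lookup_single when_def in_keys_iff)
qed

lemma additive_sum:
  fixes f :: "'a::comm_monoid_add \<Rightarrow> 'b::ab_group_add"
  assumes "\<And>a b. f (a + b) = f a + f b"
  shows "f (sum g A) = (\<Sum>a\<in>A. f (g a))"
proof -
  have "f 0 = 0" using assms[of 0 0] by simp
  then show ?thesis by (induction A rule: infinite_finite_induct) (auto simp: assms)
qed

text \<open>Every polynomial is a sum of monomials, so identities between biadditive expressions need only be
  checked on monomials. This gives multiplicativity of substitution and the formula for the homogeneous
  components of a product.\<close>

lemma biadditive_eqI: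
  fixes F G :: "('a \<Rightarrow>\<^sub>0 'c::ab_group_add) \<Rightarrow> ('a \<Rightarrow>\<^sub>0 'c) \<Rightarrow> 'b::ab_group_add"
  assumes "\<And>p p' q. F (p + p') q = F p q + F p' q" "\<And>p q q'. F p (q + q') = F p q + F p q'"
    and "\<And>p p' q. G (p + p') q = G p q + G p' q" "\<And>p q q'. G p (q + q') = G p q + G p q'"
    and eq: "\<And>s t a b. F (Poly_Mapping.single s a) (Poly_Mapping.single t b) =
                         G (Poly_Mapping.single s a) (Poly_Mapping.single t b)"
  shows "F p q = G p q"
proof -
  have expand: "H p q = (\<Sum>s\<in>Poly_Mapping.keys p. \<Sum>t\<in>Poly_Mapping.keys q.
       H (Poly_Mapping.single s (Poly_Mapping.lookup p s))
         (Poly_Mapping.single t (Poly_Mapping.lookup q t)))"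
    if 1: "\<And>p p' q. H (p + p') q = H p q + H p' q"
      and 2: "\<And>p q q'. H p (q + q') = H p q + H p q'"
    for H :: "('a \<Rightarrow>\<^sub>0 'c) \<Rightarrow> ('a \<Rightarrow>\<^sub>0 'c) \<Rightarrow> 'b"
  proof -
    have "H p q = (\<Sum>s\<in>Poly_Mapping.keys p. H (Poly_Mapping.single s (Poly_Mapping.lookup p s)) q)"
      by (subst sum_monomials[of p], rule additive_sum) (rule 1)
    also have "\<dots> = (\<Sum>s\<in>Poly_Mapping.keys p. \<Sum>t\<in>Poly_Mapping.keys q.
       H (Poly_Mapping.single s (Poly_Mapping.lookup p s))
         (Poly_Mapping.single t (Poly_Mapping.lookup q t)))"
      by (rule sum.cong[OF refl], subst (1) sum_monomials[of q], rule additive_sum) (rule 2)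
    finally show ?thesis .
  qed
  show ?thesis
    using expand[of F] expand[of G] assms by simp
qed

section \<open>Substitution of polynomials for variables\<close>

definition mono_eval :: "(gen \<Rightarrow> 'k::comm_ring_1 mpoly) \<Rightarrow> (gen \<Rightarrow>\<^sub>0 nat) \<Rightarrow> 'k mpoly" where
  "mono_eval \<sigma> t = (\<Prod>v\<in>Poly_Mapping.keys t. \<sigma> v ^ Poly_Mapping.lookup t v)"

definition subst :: "(gen \<Rightarrow> 'k::comm_ring_1 mpoly) \<Rightarrow> 'k mpoly \<Rightarrow> 'k mpoly" where
  "subst \<sigma> p = (\<Sum>t\<in>Poly_Mapping.keys p. Const (Poly_Mapping.lookup p t) * mono_eval \<sigma> t)"

lemma mono_eval_superset:
  assumes "finite A" "Poly_Mapping.keys t \<subseteq> A"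
  shows "mono_eval \<sigma> t = (\<Prod>v\<in>A. \<sigma> v ^ Poly_Mapping.lookup t v)"
  unfolding mono_eval_def
  by (rule prod.mono_neutral_left) (use assms in \<open>auto simp: in_keys_iff\<close>)

lemma mono_eval_add: "mono_eval \<sigma> (s + t) = mono_eval \<sigma> s * mono_eval \<sigma> t"
proof -
  let ?A = "Poly_Mapping.keys s \<union> Poly_Mapping.keys t"
  have "finite ?A" by simp
  then show ?thesis
    by (simp add: mono_eval_superset[of ?A] keys_add_nat lookup_add power_add prod.distrib)
qed

lemma mono_eval_Var: "mono_eval Var t = Poly_Mapping.single t 1"
proof -
  have pow: "(Var v :: 'a mpoly) ^ e = Poly_Mapping.single (Poly_Mapping.single v e) 1" for v e
    by (induction e) (simp_all add: Var_def mult_single flip: single_add)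
  have "(\<Prod>v\<in>A. (Var v :: 'a mpoly) ^ Poly_Mapping.lookup t v) =
      Poly_Mapping.single (\<Sum>v\<in>A. Poly_Mapping.single v (Poly_Mapping.lookup t v)) 1"
    if "finite A" for A
    using that by induction (simp_all add: pow mult_single)
  from this[OF finite_keys, of t] show ?thesis
    by (simp add: mono_eval_def flip: sum_monomials)
qed

lemma Const_mult_single: "Const c * Poly_Mapping.single t a = Poly_Mapping.single t (c * a)"
  by (simp add: Const_def mult_single)

lemma subst_Var: "subst Var p = p"
  unfolding subst_def mono_eval_Var Const_mult_single
  by (simp flip: sum_monomials)

lemma Const_add: "Const (a + b) = Const a + Const b"
  by (simp add: Const_def single_add)

lemma Const_mult: "Const (a * b) = Const a * Const b"
  by (simp add: Const_def mult_single)

lemma Const_zero [simp]: "Const 0 = 0"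
  by (simp add: Const_def)

lemma subst_superset:
  assumes "finite A" "Poly_Mapping.keys p \<subseteq> A"
  shows "subst \<sigma> p = (\<Sum>t\<in>A. Const (Poly_Mapping.lookup p t) * mono_eval \<sigma> t)"
  unfolding subst_def
  by (rule sum.mono_neutral_left) (use assms in \<open>auto simp: in_keys_iff\<close>)

lemma subst_single: "subst \<sigma> (Poly_Mapping.single t c) = Const c * mono_eval \<sigma> t"
  by (subst subst_superset[of "{t}"]) auto

lemma subst_add: "subst \<sigma> (p + q) = subst \<sigma> p + subst \<sigma> q"
proof -
  let ?A = "Poly_Mapping.keys p \<union> Poly_Mapping.keys q"
  have "finite ?A" by simp
  then show ?thesis
    using Poly_Mapping.keys_add[of p q]
    by (simp add: subst_superset[of ?A] lookup_add Const_add distrib_right sum.distrib)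
qed

lemma subst_mult: "subst \<sigma> (p * q) = subst \<sigma> p * subst \<sigma> q"
  by (rule biadditive_eqI[where F = "\<lambda>p q. subst \<sigma> (p * q)" and G = "\<lambda>p q. subst \<sigma> p * subst \<sigma> q"])
    (simp_all add: algebra_simps subst_add mult_single subst_single mono_eval_add Const_mult)

lemma subst_Const: "subst \<sigma> (Const c) = Const c"
  by (simp add: Const_def subst_single mono_eval_def)

lemma subst_Var_gen: "subst \<sigma> (Var v) = \<sigma> v"
  by (simp add: Var_def subst_single mono_eval_def) (simp add: Const_def)

lemma subst_diff: "subst \<sigma> (p - q) = subst \<sigma> p - subst \<sigma> q"
  using subst_add[of \<sigma> "p - q" q] by simp

text \<open>Substituting the variables for themselves writes a polynomial as a sum of products of constants and
  variables; this is why the polynomials in \<open>V\<close> form the smallest set closed under the four rules.\<close>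

lemma mpoly_ring_induct [consumes 1, case_names Const Var add mult]:
  assumes "p \<in> carrier (mpoly_ring V)"
    and const: "\<And>c. Q (Const c)" and var: "\<And>v. v \<in> V \<Longrightarrow> Q (Var v)"
    and add: "\<And>p q. \<lbrakk>p \<in> carrier (mpoly_ring V); q \<in> carrier (mpoly_ring V); Q p; Q q\<rbrakk> \<Longrightarrow> Q (p + q)"
    and mult: "\<And>p q. \<lbrakk>p \<in> carrier (mpoly_ring V); q \<in> carrier (mpoly_ring V); Q p; Q q\<rbrakk> \<Longrightarrow> Q (p * q)"
  shows "Q p"
proof -
  define C where "C = {q \<in> carrier (mpoly_ring V). Q q}"
  have c: "Const c \<in> C" for c using const by (simp add: C_def mpoly_ring_Const)
  have v: "Var v \<in> C" if "v \<in> V" for v using that var by (simp add: C_def mpoly_ring_Var)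
  have a: "a + b \<in> C" if "a \<in> C" "b \<in> C" for a b using that add by (auto simp: C_def mpoly_ring_add)
  have m: "a * b \<in> C" if "a \<in> C" "b \<in> C" for a b using that mult by (auto simp: C_def mpoly_ring_mult)
  have one: "1 \<in> C" using c[of 1] by (simp add: Const_def)
  have zero: "0 \<in> C" using c[of 0] by simp
  have pow: "a ^ e \<in> C" if "a \<in> C" for a e
    using that by (induction e) (auto simp: one m)
  have prod: "prod f A \<in> C" if "\<And>a. a \<in> A \<Longrightarrow> f a \<in> C" for f and A :: "gen set"
    using that by (induction A rule: infinite_finite_induct) (auto simp: one m)
  have sum: "sum f A \<in> C" if "\<And>a. a \<in> A \<Longrightarrow> f a \<in> C" for f and A :: "(gen \<Rightarrow>\<^sub>0 nat) set"
    using that by (induction A rule: infinite_finite_induct) (auto simp: zero a)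
  have "subst Var p \<in> C"
    unfolding subst_def mono_eval_def
    by (intro sum m c prod pow v) (use assms(1) in \<open>auto simp: in_mpoly_ring\<close>)
  then show ?thesis by (simp add: subst_Var C_def)
qed

section \<open>Homogeneous components\<close>

definition hcomp :: "(gen \<Rightarrow> nat) \<Rightarrow> nat \<Rightarrow> 'k::comm_ring_1 mpoly \<Rightarrow> 'k mpoly" where
  "hcomp w i p = (\<Sum>t | t \<in> Poly_Mapping.keys p \<and> mono_weight w t = i.
                    Poly_Mapping.single t (Poly_Mapping.lookup p t))"

lemma lookup_hcomp:
  "Poly_Mapping.lookup (hcomp w i p) t = (Poly_Mapping.lookup p t when mono_weight w t = i)"
  by (auto simp: hcomp_def lookup_sum lookup_single when_def in_keys_iff)

lemma keys_hcomp: "Poly_Mapping.keys (hcomp w i p) = {t \<in> Poly_Mapping.keys p. mono_weight w t = i}"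
  by (auto simp: in_keys_iff lookup_hcomp)

lemma hcomp_add: "hcomp w i (p + q) = hcomp w i p + hcomp w i q"
  by (rule poly_mapping_eqI) (simp add: lookup_hcomp lookup_add when_def)

lemma hcomp_hcomp: "hcomp w i (hcomp w j p) = (if i = j then hcomp w j p else 0)"
  by (rule poly_mapping_eqI) (auto simp: lookup_hcomp when_def)

lemma hcomp_in_mpoly_ring: "p \<in> carrier (mpoly_ring V) \<Longrightarrow> hcomp w i p \<in> carrier (mpoly_ring V)"
  by (auto simp: in_mpoly_ring keys_hcomp)

lemma hcomp_single:
  "hcomp w i (Poly_Mapping.single t c) = (if mono_weight w t = i then Poly_Mapping.single t c else 0)"
  by (rule poly_mapping_eqI) (auto simp: lookup_hcomp lookup_single when_def)

lemma sum_hcomp: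
  assumes "\<And>t. t \<in> Poly_Mapping.keys p \<Longrightarrow> mono_weight w t \<le> N"
  shows "p = (\<Sum>i\<le>N. hcomp w i p)"
proof (rule poly_mapping_eqI)
  fix t
  show "Poly_Mapping.lookup p t = Poly_Mapping.lookup (\<Sum>i\<le>N. hcomp w i p) t"
    using assms[of t] by (auto simp: lookup_sum lookup_hcomp when_def in_keys_iff)
qed

lemma weight_bounded: "\<exists>N. \<forall>t\<in>Poly_Mapping.keys p. mono_weight w t \<le> N"
  by (rule exI[of _ "Max (mono_weight w ` Poly_Mapping.keys p)"]) simp

lemma mono_weight_add: "mono_weight w (s + t) = mono_weight w s + mono_weight w t"
proof -
  have *: "mono_weight w u = (\<Sum>v\<in>A. w v * Poly_Mapping.lookup u v)"
    if "finite A" "Poly_Mapping.keys u \<subseteq> A" for u A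
    unfolding mono_weight_def
    by (rule sum.mono_neutral_left) (use that in \<open>auto simp: in_keys_iff\<close>)
  let ?A = "Poly_Mapping.keys s \<union> Poly_Mapping.keys t"
  have "finite ?A" by simp
  then show ?thesis
    by (simp add: *[of ?A] keys_add_nat lookup_add distrib_left sum.distrib)
qed

lemma hcomp_mult: "hcomp w i (p * q) = (\<Sum>j\<le>i. hcomp w j p * hcomp w (i - j) q)"
proof (rule biadditive_eqI[where F = "\<lambda>p q. hcomp w i (p * q)"
      and G = "\<lambda>p q. \<Sum>j\<le>i. hcomp w j p * hcomp w (i - j) q"])
  fix s t :: "gen \<Rightarrow>\<^sub>0 nat" and a b :: 'a
  let ?s = "Poly_Mapping.single s a" and ?t = "Poly_Mapping.single t b"
  have "(\<Sum>j\<le>i. hcomp w j ?s * hcomp w (i - j) ?t) =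
    (\<Sum>j\<le>i. if j = mono_weight w s then ?s * hcomp w (i - j) ?t else 0)"
    by (rule sum.cong) (auto simp: hcomp_single)
  also have "\<dots> = hcomp w i (?s * ?t)"
    by (auto simp: hcomp_single mult_single mono_weight_add)
  finally show "hcomp w i (?s * ?t) = (\<Sum>j\<le>i. hcomp w j ?s * hcomp w (i - j) ?t)" ..
qed (simp_all add: algebra_simps hcomp_add sum.distrib)

lemma top_component_eq_hcomp:
  assumes "p \<noteq> 0"
  obtains i where "top_component w p = hcomp w i p"
    and "\<And>t. t \<in> Poly_Mapping.keys p \<Longrightarrow> mono_weight w t \<le> i"
    and "\<exists>t\<in>Poly_Mapping.keys p. mono_weight w t = i"
proof
  let ?i = "Max (mono_weight w ` Poly_Mapping.keys p)"
  show "top_component w p = hcomp w ?i p"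
    using assms by (simp add: top_component_def hcomp_def weight_deg_def)
  have "?i \<in> mono_weight w ` Poly_Mapping.keys p"
    using assms by (intro Max_in) auto
  then show "\<exists>t\<in>Poly_Mapping.keys p. mono_weight w t = ?i" by auto
qed simp

lemma top_component_zero: "top_component w 0 = 0"
  by (simp add: top_component_def)

section \<open>Filtrations induced by a weight on a presentation\<close>

locale filtered_presentation =
  ring_hom_cring "mpoly_ring V" B \<phi>
  for V and B (structure) and \<phi> :: "'k::comm_ring_1 mpoly \<Rightarrow> 'b" +
  fixes w :: "gen \<Rightarrow> nat"
  assumes surj: "\<phi> ` carrier (mpoly_ring V) = carrier B"
    and nontrivial: "\<one>\<^bsub>B\<^esub> \<noteq> \<zero>\<^bsub>B\<^esub>"
begin

abbreviation P :: "'k mpoly set" where "P \<equiv> carrier (mpoly_ring V)"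

text \<open>The strict bound avoids an exceptional index: the elements of filtration degree less than \<open>i\<close> are
  the image of \<open>polys_below i\<close> also for \<open>i = 0\<close>, where \<open>polys_below 0\<close> is the zero space, as the
  convention for the piece of index \<open>-1\<close> demands.\<close>

definition polys_below :: "nat \<Rightarrow> 'k mpoly set" where
  "polys_below i = {p \<in> P. \<forall>t\<in>Poly_Mapping.keys p. mono_weight w t < i}"

text \<open>The sum of \<open>polys_below i\<close> and the kernel of \<open>\<phi>\<close> (see \<open>falling_iff\<close>). Stating vanishing in the
  graded ring as a condition on polynomials keeps all computations in \<open>P\<close>.\<close>

definition falling :: "nat \<Rightarrow> 'k mpoly set" where
  "falling i = {p \<in> P. \<phi> p \<in> \<phi> ` polys_below i}"

definition image_filtration :: "nat \<Rightarrow> 'b set" where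
  "image_filtration i = \<phi> ` polys_below (i + 1)"

definition falling_ideal :: "'k mpoly set" where
  "falling_ideal = {p \<in> P. \<forall>i. hcomp w i p \<in> falling i}"

lemma phi_add: "p \<in> P \<Longrightarrow> q \<in> P \<Longrightarrow> \<phi> (p + q) = \<phi> p \<oplus>\<^bsub>B\<^esub> \<phi> q"
  using hom_add[of p q] by simp

lemma phi_mult: "p \<in> P \<Longrightarrow> q \<in> P \<Longrightarrow> \<phi> (p * q) = \<phi> p \<otimes>\<^bsub>B\<^esub> \<phi> q"
  using hom_mult[of p q] by simp

lemma phi_uminus: "p \<in> P \<Longrightarrow> \<phi> (- p) = \<ominus>\<^bsub>B\<^esub> \<phi> p"
  using hom_a_inv[of p] by (simp add: mpoly_ring_a_inv)

lemma phi_zero: "\<phi> 0 = \<zero>\<^bsub>B\<^esub>"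
  using hom_zero by simp

lemma phi_one: "\<phi> 1 = \<one>\<^bsub>B\<^esub>"
  using hom_one by simp

lemma phi_diff: "p \<in> P \<Longrightarrow> q \<in> P \<Longrightarrow> \<phi> (p - q) = \<phi> p \<ominus>\<^bsub>B\<^esub> \<phi> q"
  using phi_add[of p "- q"] by (simp add: phi_uminus mpoly_ring_uminus a_minus_def)

lemma polys_below_subset: "polys_below i \<subseteq> P"
  by (auto simp: polys_below_def)

lemma polys_below_mono: "i \<le> j \<Longrightarrow> polys_below i \<subseteq> polys_below j"
  by (fastforce simp: polys_below_def)

lemma polys_below_0: "polys_below 0 = {0}"
  by (auto simp: polys_below_def mpoly_ring_zero)

lemma polys_below_exhausts:
  assumes "p \<in> P"
  obtains i where "p \<in> polys_below (i + 1)"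
proof -
  obtain N where "\<forall>t\<in>Poly_Mapping.keys p. mono_weight w t \<le> N"
    using weight_bounded by blast
  then have "p \<in> polys_below (N + 1)" using assms by (fastforce simp: polys_below_def)
  then show ?thesis by (rule that)
qed

lemma polys_below_add: "p \<in> polys_below i \<Longrightarrow> q \<in> polys_below i \<Longrightarrow> p + q \<in> polys_below i"
  using Poly_Mapping.keys_add[of p q] by (auto simp: polys_below_def mpoly_ring_add)

lemma polys_below_uminus: "p \<in> polys_below i \<Longrightarrow> - p \<in> polys_below i"
  by (auto simp: polys_below_def mpoly_ring_uminus)

lemma polys_below_mult: "p \<in> polys_below (i + 1) \<Longrightarrow> q \<in> polys_below j \<Longrightarrow> p * q \<in> polys_below (i + j)"
  using keys_mult[of p q] by (fastforce simp: polys_below_def mpoly_ring_mult mono_weight_add)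

lemma hcomp_in_polys_below: "p \<in> P \<Longrightarrow> hcomp w i p \<in> polys_below (i + 1)"
  by (auto simp: polys_below_def keys_hcomp hcomp_in_mpoly_ring)

lemma diff_hcomp_in_polys_below: "p \<in> polys_below (i + 1) \<Longrightarrow> p - hcomp w i p \<in> polys_below i"
proof -
  assume p: "p \<in> polys_below (i + 1)"
  have "mono_weight w t < i" if "t \<in> Poly_Mapping.keys (p - hcomp w i p)" for t
  proof -
    have "t \<in> Poly_Mapping.keys p" "mono_weight w t \<noteq> i"
      using that by (auto simp: in_keys_iff lookup_minus lookup_hcomp when_def split: if_splits)
    with p show ?thesis by (fastforce simp: polys_below_def)
  qed
  then show ?thesis
    using p by (simp add: polys_below_def mpoly_ring_diff hcomp_in_mpoly_ring)
qed

lemma falling_iff: "p \<in> falling i \<longleftrightarrow> p \<in> P \<and> (\<exists>q\<in>polys_below i. \<phi> (p - q) = \<zero>\<^bsub>B\<^esub>)"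
proof -
  have "\<phi> p = \<phi> q \<longleftrightarrow> \<phi> (p - q) = \<zero>\<^bsub>B\<^esub>" if "p \<in> P" "q \<in> polys_below i" for q
    using that polys_below_subset[of i] by (auto simp: phi_diff subsetD)
  then show ?thesis unfolding falling_def by blast
qed

lemma falling_subset: "falling i \<subseteq> P"
  by (auto simp: falling_def)

lemma polys_below_subset_falling: "polys_below i \<subseteq> falling i"
  using polys_below_subset by (auto simp: falling_def)

lemma falling_add:
  assumes "p \<in> falling i" "q \<in> falling i" shows "p + q \<in> falling i"
proof -
  obtain p' q' where "p' \<in> polys_below i" "q' \<in> polys_below i" "\<phi> p = \<phi> p'" "\<phi> q = \<phi> q'"
    using assms by (auto simp: falling_def)
  then have "\<phi> (p + q) = \<phi> (p' + q')"
    using assms polys_below_subset[of i] falling_subset[of i] by (simp add: phi_add subset_iff)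
  then show ?thesis
    using polys_below_add[OF \<open>p' \<in> polys_below i\<close> \<open>q' \<in> polys_below i\<close>] assms falling_subset[of i]
    by (auto simp: falling_def mpoly_ring_add)
qed

text \<open>The weight bound on \<open>p\<close> lets it multiply a representative of \<open>q\<close> with weights less than \<open>j\<close>
  into one with weights less than \<open>i + j\<close>. This is the well-definedness of multiplication in the graded
  ring.\<close>

lemma falling_mult:
  assumes "p \<in> polys_below (i + 1)" "q \<in> falling j" shows "p * q \<in> falling (i + j)"
proof -
  obtain q' where q': "q' \<in> polys_below j" "\<phi> q = \<phi> q'"
    using assms by (auto simp: falling_def)
  have P: "p \<in> P" "q \<in> P" "q' \<in> P"
    using assms q' polys_below_subset falling_subset by blast+
  then have "\<phi> (p * q) = \<phi> (p * q')"
    by (simp add: phi_mult q')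
  then show ?thesis
    using polys_below_mult[OF assms(1) q'(1)] P by (auto simp: falling_def mpoly_ring_mult)
qed

lemma falling_zero: "0 \<in> falling i"
  using polys_below_subset_falling[of i] polys_below_mono[of 0 i] by (auto simp: polys_below_0)

lemma falling_sum: "(\<And>a. a \<in> A \<Longrightarrow> f a \<in> falling i) \<Longrightarrow> sum f A \<in> falling i"
  by (induction A rule: infinite_finite_induct) (auto simp: falling_zero falling_add)

lemma falling_uminus:
  assumes "p \<in> falling i" shows "- p \<in> falling i"
proof -
  have "1 \<in> polys_below (0 + 1)" by (simp add: polys_below_def mpoly_ring_one mono_weight_def)
  then show ?thesis using falling_mult[OF polys_below_uminus assms] by fastforce
qed

lemma falling_cong: "p - q \<in> falling i \<Longrightarrow> p \<in> falling i \<longleftrightarrow> q \<in> falling i"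
  using falling_add[of "p - q" i q] falling_add[of "- (p - q)" i p] falling_uminus[of "p - q" i] by auto

lemma falling_ideal_subset: "falling_ideal \<subseteq> P"
  by (auto simp: falling_ideal_def)

lemma falling_ideal_add: "p \<in> falling_ideal \<Longrightarrow> q \<in> falling_ideal \<Longrightarrow> p + q \<in> falling_ideal"
  by (simp add: falling_ideal_def hcomp_add falling_add mpoly_ring_add)

lemma falling_ideal_mult:
  assumes "p \<in> P" "q \<in> falling_ideal" shows "p * q \<in> falling_ideal"
proof -
  have "hcomp w i (p * q) \<in> falling i" for i
    unfolding hcomp_mult
  proof (rule falling_sum)
    fix j assume "j \<in> {..i}"
    then show "hcomp w j p * hcomp w (i - j) q \<in> falling i"
      using falling_mult[of "hcomp w j p" j "hcomp w (i - j) q" "i - j"] hcomp_in_polys_below[of p j] assms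
      by (simp add: falling_ideal_def)
  qed
  then show ?thesis using assms falling_ideal_subset by (auto simp: falling_ideal_def mpoly_ring_mult)
qed

lemma hcomp_in_falling_ideal_iff:
  assumes "p \<in> P"
  shows "hcomp w i p \<in> falling_ideal \<longleftrightarrow> hcomp w i p \<in> falling i"
  using assms by (auto simp: falling_ideal_def hcomp_hcomp hcomp_in_mpoly_ring falling_zero)

lemma ideal_falling_ideal: "ideal falling_ideal (mpoly_ring V)"
proof (rule idealI)
  show "ring (mpoly_ring V)" by (rule cring.axioms(1)[OF cring_mpoly_ring])
  have "0 \<in> falling_ideal"
    using hcomp_in_falling_ideal_iff[of 0 0]
    by (simp add: falling_ideal_def hcomp_def falling_zero mpoly_ring_zero)
  moreover have "- p \<in> falling_ideal" if "p \<in> falling_ideal" for p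
    using falling_ideal_mult[of "- 1" p] that mpoly_ring_uminus[OF mpoly_ring_one, of V] by simp
  ultimately show "subgroup falling_ideal (add_monoid (mpoly_ring V))"
    using falling_ideal_subset by (intro R.add.subgroupI)
      (auto simp: falling_ideal_add mpoly_ring_a_inv subset_iff simp flip: a_inv_def)
  fix p q assume "p \<in> falling_ideal" "q \<in> P"
  then show "q \<otimes>\<^bsub>mpoly_ring V\<^esub> p \<in> falling_ideal" "p \<otimes>\<^bsub>mpoly_ring V\<^esub> q \<in> falling_ideal"
    using falling_ideal_mult[of q p] by (simp_all add: mult.commute)
qed

text \<open>If \<open>p\<close> has image zero, its highest component has the same image as minus the rest of \<open>p\<close>, whose
  weights are smaller.\<close>

lemma top_component_kernel_in_falling_ideal:
  assumes "p \<in> P" "\<phi> p = \<zero>\<^bsub>B\<^esub>"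
  shows "top_component w p \<in> falling_ideal"
proof (cases "p = 0")
  case True
  then show ?thesis
    using additive_subgroup.zero_closed[OF ideal.axioms(1)[OF ideal_falling_ideal]]
    by (simp add: top_component_zero)
next
  case False
  then obtain i where i: "top_component w p = hcomp w i p"
    "\<And>t. t \<in> Poly_Mapping.keys p \<Longrightarrow> mono_weight w t \<le> i"
    using top_component_eq_hcomp[of p w] by blast
  have "p \<in> polys_below (i + 1)" using i(2) assms(1) by (fastforce simp: polys_below_def)
  then have "hcomp w i p - p \<in> falling i"
    using falling_uminus polys_below_subset_falling diff_hcomp_in_polys_below by fastforce
  moreover have "p \<in> falling i"
    using assms polys_below_subset_falling[of i] falling_zero[of i] by (simp add: falling_def phi_zero)
  ultimately have "hcomp w i p \<in> falling i"
    using falling_cong by blast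
  then show ?thesis using assms i(1) by (simp add: hcomp_in_falling_ideal_iff)
qed

text \<open>Conversely, if the component \<open>p\<^sub>i\<close> has the same image as a \<open>q\<close> with weights less than \<open>i\<close>, then
  \<open>p\<^sub>i - q\<close> lies in the kernel and, unless \<open>p\<^sub>i = 0\<close>, its highest component is \<open>p\<^sub>i\<close>.\<close>

lemma homogeneous_in_top_ideal:
  assumes "p \<in> P" "hcomp w i p \<in> falling i"
  shows "hcomp w i p \<in> top_ideal w V {q \<in> P. \<phi> q = \<zero>\<^bsub>B\<^esub>}"
proof -
  let ?K = "{q \<in> P. \<phi> q = \<zero>\<^bsub>B\<^esub>}"
  have tops: "top_component w ` ?K \<subseteq> P"
    using top_component_kernel_in_falling_ideal falling_ideal_subset by auto
  obtain q where q: "q \<in> polys_below i" "\<phi> (hcomp w i p - q) = \<zero>\<^bsub>B\<^esub>"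
    using assms(2) by (auto simp: falling_iff)
  let ?f = "hcomp w i p - q"
  have f: "?f \<in> ?K"
    using q assms polys_below_subset[of i] by (auto simp: mpoly_ring_diff hcomp_in_mpoly_ring subset_iff)
  have q0: "Poly_Mapping.lookup q t = 0" if "mono_weight w t \<ge> i" for t
  proof -
    have "t \<notin> Poly_Mapping.keys q" using q(1) that by (auto simp: polys_below_def)
    then show ?thesis by (simp add: in_keys_iff)
  qed
  show ?thesis
  proof (cases "hcomp w i p = 0")
    case True
    interpret ideal "top_ideal w V ?K" "mpoly_ring V"
      unfolding top_ideal_def by (rule R.genideal_ideal[OF tops])
    from True show ?thesis using zero_closed by simp
  next
    case False
    have hf: "hcomp w i ?f = hcomp w i p"
      by (rule poly_mapping_eqI) (simp add: lookup_hcomp lookup_minus when_def q0)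
    have fi: "Poly_Mapping.lookup ?f t = 0" if "mono_weight w t > i" for t
      using that by (simp add: lookup_minus lookup_hcomp q0)
    obtain t where t: "t \<in> Poly_Mapping.keys ?f" "mono_weight w t = i"
    proof -
      have "Poly_Mapping.keys (hcomp w i ?f) \<noteq> {}" using False by (simp add: hf)
      then show ?thesis using that by (auto simp only: keys_hcomp)
    qed
    have "?f \<noteq> 0" using t by auto
    then obtain j where j: "top_component w ?f = hcomp w j ?f"
      "\<And>t. t \<in> Poly_Mapping.keys ?f \<Longrightarrow> mono_weight w t \<le> j"
      and attained: "\<exists>u\<in>Poly_Mapping.keys ?f. mono_weight w u = j"
      by (rule top_component_eq_hcomp) blast
    have "\<not> j > i" using attained fi by (auto simp: in_keys_iff)
    then have "j = i" using j(2)[OF t(1)] t(2) by simp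
    then have "hcomp w i p = top_component w ?f" by (simp add: j hf)
    then show ?thesis
      using R.genideal_self[OF tops] f unfolding top_ideal_def by blast
  qed
qed

lemma top_ideal_kernel_eq_falling_ideal: "top_ideal w V {q \<in> P. \<phi> q = \<zero>\<^bsub>B\<^esub>} = falling_ideal"
proof
  let ?K = "{q \<in> P. \<phi> q = \<zero>\<^bsub>B\<^esub>}"
  show "top_ideal w V ?K \<subseteq> falling_ideal"
    unfolding top_ideal_def
    by (rule R.genideal_minimal[OF ideal_falling_ideal]) (auto intro: top_component_kernel_in_falling_ideal)
  show "falling_ideal \<subseteq> top_ideal w V ?K"
  proof
    fix p assume p: "p \<in> falling_ideal"
    have tops: "top_component w ` ?K \<subseteq> P"
      using top_component_kernel_in_falling_ideal falling_ideal_subset by auto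
    interpret I: ideal "top_ideal w V ?K" "mpoly_ring V"
      unfolding top_ideal_def by (rule R.genideal_ideal[OF tops])
    obtain N where N: "\<forall>t\<in>Poly_Mapping.keys p. mono_weight w t \<le> N"
      using weight_bounded by blast
    have add: "a + b \<in> top_ideal w V ?K" if "a \<in> top_ideal w V ?K" "b \<in> top_ideal w V ?K" for a b
      using I.a_closed[OF that] by simp
    have "(\<Sum>i\<in>A. hcomp w i p) \<in> top_ideal w V ?K" if "finite A" for A
      using that
    proof (induction A)
      case empty
      then show ?case using I.zero_closed by simp
    next
      case (insert i A)
      have "hcomp w i p \<in> top_ideal w V ?K"
        using p by (intro homogeneous_in_top_ideal) (auto simp: falling_ideal_def)
      then show ?case using insert by (simp add: add)
    qed
    then show "p \<in> top_ideal w V ?K"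
      using sum_hcomp[of p w N] N by (metis (no_types, lifting) finite_atMost)
  qed
qed

lemma one_notin_falling: "1 \<notin> falling 0"
  using nontrivial by (simp add: falling_def polys_below_0 phi_zero phi_one)

lemma N_filtration_image: "N_filtration (\<phi> ` range Const) B image_filtration"
  unfolding N_filtration_def
proof (intro conjI allI ballI)
  show "subalgebra (\<phi> ` range Const) (image_filtration i) B" for i
    unfolding image_filtration_def
  proof (rule ring_hom_ring.img_is_subalgebra[OF ring.is_ring_hom_ring])
    show "range Const \<subseteq> P" by (auto simp: mpoly_ring_Const)
    show "subalgebra (range Const) (polys_below (i + 1)) (mpoly_ring V)"
    proof (intro subalgebra.intro subalgebra_axioms.intro)
      have "0 \<in> polys_below (i + 1)" using polys_below_mono[of 0 "i + 1"] by (simp add: polys_below_0)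
      then show "subgroup (polys_below (i + 1)) (add_monoid (mpoly_ring V))"
        using polys_below_subset[of "i + 1"] by (intro R.add.subgroupI)
          (auto simp: polys_below_add polys_below_uminus mpoly_ring_a_inv subset_iff simp flip: a_inv_def)
      fix c p :: "'k mpoly" assume "c \<in> range Const" "p \<in> polys_below (i + 1)"
      moreover have "Const a \<in> polys_below (0 + 1)" for a
        by (simp add: polys_below_def mpoly_ring_Const) (simp add: Const_def mono_weight_def)
      ultimately have "c * p \<in> polys_below (0 + (i + 1))"
        by (intro polys_below_mult) blast+
      then show "c \<otimes>\<^bsub>mpoly_ring V\<^esub> p \<in> polys_below (i + 1)" by simp
    qed
  qed
  show "image_filtration i \<subseteq> image_filtration (i + 1)" for i
    unfolding image_filtration_def by (intro image_mono polys_below_mono) simp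
  have "image_filtration i \<subseteq> carrier B" for i
    unfolding image_filtration_def using polys_below_subset surj by blast
  moreover have "carrier B \<subseteq> (\<Union>i. image_filtration i)"
  proof
    fix b assume "b \<in> carrier B"
    then obtain p where p: "p \<in> P" "b = \<phi> p" using surj by blast
    from p(1) obtain i where "p \<in> polys_below (i + 1)" by (rule polys_below_exhausts)
    then show "b \<in> (\<Union>i. image_filtration i)" using p by (auto simp: image_filtration_def)
  qed
  ultimately show "carrier B = (\<Union>i. image_filtration i)" by blast
  fix i j a b assume "a \<in> image_filtration i" "b \<in> image_filtration j"
  then obtain p q where pq: "p \<in> polys_below (i + 1)" "q \<in> polys_below (j + 1)" "a = \<phi> p" "b = \<phi> q"
    by (auto simp: image_filtration_def)
  then have "a \<otimes>\<^bsub>B\<^esub> b = \<phi> (p * q)"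
    using polys_below_subset by (simp add: phi_mult subset_iff)
  then show "a \<otimes>\<^bsub>B\<^esub> b \<in> image_filtration (i + j)"
    using polys_below_mult[OF pq(1,2)] by (simp add: image_filtration_def add.assoc)
qed

lemma layer_image_filtration: "layer B image_filtration i = \<phi> ` (polys_below (i + 1) - falling i)"
proof -
  have "(if i = 0 then {\<zero>\<^bsub>B\<^esub>} else image_filtration (i - 1)) = \<phi> ` polys_below i"
    by (simp add: image_filtration_def polys_below_0 phi_zero)
  then have "layer B image_filtration i = \<phi> ` polys_below (i + 1) - \<phi> ` polys_below i"
    unfolding layer_def by (simp add: image_filtration_def)
  also have "\<dots> = \<phi> ` (polys_below (i + 1) - falling i)"
    using polys_below_subset by (auto simp: falling_def)
  finally show ?thesis .
qed

lemma proper_iff: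
  "proper_N_filtration (\<phi> ` range Const) B image_filtration \<longleftrightarrow>
     (\<forall>i j. \<forall>p \<in> polys_below (i + 1) - falling i. \<forall>q \<in> polys_below (j + 1) - falling j. p * q \<notin> falling (i + j))"
proof -
  have "\<phi> p \<otimes>\<^bsub>B\<^esub> \<phi> q \<in> layer B image_filtration (i + j) \<longleftrightarrow> p * q \<notin> falling (i + j)"
    if "p \<in> polys_below (i + 1)" "q \<in> polys_below (j + 1)" for p q i j
  proof -
    have pq: "p * q \<in> polys_below (i + j + 1)" using polys_below_mult[OF that] by (simp add: add.assoc)
    have P: "p \<in> P" "q \<in> P" "p * q \<in> P" using that pq polys_below_subset by blast+
    have falling_resp: "f \<in> falling k \<longleftrightarrow> g \<in> falling k" if "\<phi> f = \<phi> g" "f \<in> P" "g \<in> P" for f g k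
      using that by (simp add: falling_def)
    have "\<phi> (p * q) \<in> \<phi> ` (polys_below (i + j + 1) - falling (i + j)) \<longleftrightarrow> p * q \<notin> falling (i + j)"
    proof
      assume "\<phi> (p * q) \<in> \<phi> ` (polys_below (i + j + 1) - falling (i + j))"
      then obtain f where "f \<in> polys_below (i + j + 1)" "f \<notin> falling (i + j)" "\<phi> (p * q) = \<phi> f" by blast
      then show "p * q \<notin> falling (i + j)" using falling_resp[of "p * q" f] P polys_below_subset by blast
    next
      assume "p * q \<notin> falling (i + j)"
      with pq show "\<phi> (p * q) \<in> \<phi> ` (polys_below (i + j + 1) - falling (i + j))" by blast
    qed
    then show ?thesis by (simp only: layer_image_filtration phi_mult P)
  qed
  then have "(\<forall>p\<in>polys_below (i + 1) - falling i. \<forall>q\<in>polys_below (j + 1) - falling j. \<phi> p \<otimes>\<^bsub>B\<^esub> \<phi> q \<in> layer B image_filtration (i + j)) \<longleftrightarrow>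
      (\<forall>p\<in>polys_below (i + 1) - falling i. \<forall>q\<in>polys_below (j + 1) - falling j. p * q \<notin> falling (i + j))" for i j
    by blast
  then show ?thesis
    unfolding proper_N_filtration_def
    using N_filtration_image by (simp only: layer_image_filtration simp_thms ball_simps)
qed

text \<open>The index found here is the degree of the class of \<open>p\<close> modulo the ideal. The class of a product
  of two such polynomials has the product of their components at these indices as its part of highest
  degree, provided that this product is not in the ideal.\<close>

lemma greatest_bad_component:
  assumes "p \<in> P" "p \<notin> falling_ideal"
  obtains i where "hcomp w i p \<notin> falling i" "\<And>j. j > i \<Longrightarrow> hcomp w j p \<in> falling j"
proof -
  obtain N where N: "\<forall>t\<in>Poly_Mapping.keys p. mono_weight w t \<le> N"
    using weight_bounded by blast
  have "hcomp w j p = 0" if "j > N" for j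
  proof -
    have "Poly_Mapping.keys (hcomp w j p) = {}" using N that by (auto simp: keys_hcomp)
    then show ?thesis by simp
  qed
  then have bound: "j \<le> N" if "hcomp w j p \<notin> falling j" for j
    using that falling_zero by (metis not_le)
  let ?S = "{j. hcomp w j p \<notin> falling j}"
  have fin: "finite ?S" using bound by (meson finite_nat_set_iff_bounded_le mem_Collect_eq)
  moreover have "?S \<noteq> {}" using assms by (auto simp: falling_ideal_def)
  ultimately have "Max ?S \<in> ?S" by (rule Max_in)
  moreover have "hcomp w j p \<in> falling j" if "j > Max ?S" for j
    using Max_ge[OF fin, of j] that by auto
  ultimately show ?thesis using that by blast
qed

text \<open>If the filtration is proper and \<open>p\<close>, \<open>q\<close> lie outside the ideal, let \<open>i\<close>, \<open>j\<close> be the greatest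
  indices of components \<open>p\<^sub>i\<close>, \<open>q\<^sub>j\<close> that do not fall. Up to terms that fall below \<open>i + j\<close> the
  component of \<open>p q\<close> of weight \<open>i + j\<close> is \<open>p\<^sub>i q\<^sub>j\<close>, which does not fall. If the ideal is prime,
  then a polynomial of weight at most \<open>i\<close> may be replaced by its component of weight \<open>i\<close>, because
  the difference lies in \<open>polys_below i\<close>; and a product of homogeneous polynomials is homogeneous, so
  that it falls if and only if it lies in the ideal.\<close>

theorem proper_iff_primeideal:
  "proper_N_filtration (\<phi> ` range Const) B image_filtration \<longleftrightarrow>
     primeideal (top_ideal w V {q \<in> P. \<phi> q = \<zero>\<^bsub>B\<^esub>}) (mpoly_ring V)"
  unfolding top_ideal_kernel_eq_falling_ideal
proof
  assume "proper_N_filtration (\<phi> ` range Const) B image_filtration"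
  then have proper: "p * q \<notin> falling (i + j)"
    if "p \<in> polys_below (i + 1)" "p \<notin> falling i" "q \<in> polys_below (j + 1)" "q \<notin> falling j" for p q i j
    using that unfolding proper_iff by blast
  show "primeideal falling_ideal (mpoly_ring V)"
  proof (rule primeidealI[OF ideal_falling_ideal R.is_cring])
    have "hcomp w 0 1 = (1 :: 'k mpoly)"
      by (rule poly_mapping_eqI) (auto simp: lookup_hcomp lookup_one when_def mono_weight_def)
    then have "1 \<notin> falling_ideal"
      using hcomp_in_falling_ideal_iff[of 1 0] one_notin_falling by (simp add: mpoly_ring_one)
    then show "P \<noteq> falling_ideal" using mpoly_ring_one[of V] by metis
    fix p q assume pq: "p \<in> P" "q \<in> P" and "p \<otimes>\<^bsub>mpoly_ring V\<^esub> q \<in> falling_ideal"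
    then have prod: "p * q \<in> falling_ideal" by simp
    show "p \<in> falling_ideal \<or> q \<in> falling_ideal"
    proof (rule ccontr)
      assume "\<not> (p \<in> falling_ideal \<or> q \<in> falling_ideal)"
      then obtain i j where i: "hcomp w i p \<notin> falling i" "\<And>k. k > i \<Longrightarrow> hcomp w k p \<in> falling k"
        and j: "hcomp w j q \<notin> falling j" "\<And>k. k > j \<Longrightarrow> hcomp w k q \<in> falling k"
        using greatest_bad_component pq by metis
      let ?f = "\<lambda>k. hcomp w k p * hcomp w (i + j - k) q"
      \<comment> \<open>If \<open>k \<noteq> i\<close>, then \<open>k > i\<close> or \<open>i + j - k > j\<close>, so one of the two factors falls.\<close>
      have rest: "(\<Sum>k\<in>{..i + j} - {i}. ?f k) \<in> falling (i + j)"
      proof (rule falling_sum)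
        fix k assume k: "k \<in> {..i + j} - {i}"
        show "?f k \<in> falling (i + j)"
        proof (cases "k > i")
          case True
          then show ?thesis
            using falling_mult[OF hcomp_in_polys_below[OF pq(2)] i(2)[OF True], of "i + j - k"] k
            by (simp add: mult.commute)
        next
          case False
          then have "i + j - k > j" using k by auto
          then show ?thesis
            using falling_mult[OF hcomp_in_polys_below[OF pq(1)] j(2), of "i + j - k" k] k by simp
        qed
      qed
      have "hcomp w (i + j) (p * q) = ?f i + (\<Sum>k\<in>{..i + j} - {i}. ?f k)"
        unfolding hcomp_mult by (rule sum.remove) auto
      then have "?f i \<in> falling (i + j) \<longleftrightarrow> hcomp w (i + j) (p * q) \<in> falling (i + j)"
        using falling_cong[of "hcomp w (i + j) (p * q)" "?f i" "i + j"] rest by simp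
      then have "hcomp w i p * hcomp w j q \<in> falling (i + j)"
        using prod by (simp add: falling_ideal_def)
      then show False
        using proper[OF hcomp_in_polys_below i(1) hcomp_in_polys_below j(1)] pq by blast
    qed
  qed
next
  assume "primeideal falling_ideal (mpoly_ring V)"
  then interpret prime: primeideal falling_ideal "mpoly_ring V" .
  show "proper_N_filtration (\<phi> ` range Const) B image_filtration"
    unfolding proper_iff
  proof (intro allI ballI)
    fix i j p q assume "p \<in> polys_below (i + 1) - falling i" "q \<in> polys_below (j + 1) - falling j"
    then have p: "p \<in> polys_below (i + 1)" "p \<notin> falling i" and q: "q \<in> polys_below (j + 1)" "q \<notin> falling j" by auto
    let ?p = "hcomp w i p" and ?q = "hcomp w j q"
    have P: "p \<in> P" "q \<in> P" using p q polys_below_subset by blast+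
    have dp: "p - ?p \<in> polys_below i" and dq: "q - ?q \<in> polys_below j"
      using p q diff_hcomp_in_polys_below by auto
    have "?p \<notin> falling_ideal" "?q \<notin> falling_ideal"
      using falling_cong[of p ?p i] falling_cong[of q ?q j] dp dq p q P
        polys_below_subset_falling hcomp_in_falling_ideal_iff by blast+
    then have "?p * ?q \<notin> falling_ideal"
      using prime.I_prime[of ?p ?q] P hcomp_in_mpoly_ring by auto
    moreover have "hcomp w (i + j) (?p * ?q) = ?p * ?q"
    proof (rule poly_mapping_eqI)
      fix t
      have "mono_weight w t = i + j" if "t \<in> Poly_Mapping.keys (?p * ?q)"
        using keys_mult[of ?p ?q] that by (auto simp: keys_hcomp mono_weight_add)
      then show "Poly_Mapping.lookup (hcomp w (i + j) (?p * ?q)) t = Poly_Mapping.lookup (?p * ?q) t"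
        by (auto simp: lookup_hcomp when_def in_keys_iff)
    qed
    ultimately have "?p * ?q \<notin> falling (i + j)"
      using hcomp_in_falling_ideal_iff[of "?p * ?q" "i + j"] P by (simp add: mpoly_ring_mult hcomp_in_mpoly_ring)
    moreover have "p * q - ?p * ?q \<in> falling (i + j)"
    proof -
      have "p * q - ?p * ?q = p * (q - ?q) + ?q * (p - ?p)" by (simp add: algebra_simps)
      moreover have "p * (q - ?q) \<in> falling (i + j)"
        using polys_below_mult[OF p(1) dq] polys_below_subset_falling by blast
      moreover have "?q * (p - ?p) \<in> falling (i + j)"
        using polys_below_mult[OF hcomp_in_polys_below[OF P(2)] dp] polys_below_subset_falling by (metis add.commute subsetD)
      ultimately show ?thesis by (simp add: falling_add)
    qed
    ultimately show "p * q \<notin> falling (i + j)" using falling_cong by blast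
  qed
qed

lemma phi_closed: "p \<in> P \<Longrightarrow> \<phi> p \<in> carrier B"
  using surj by blast

lemma phi_sum: "(\<And>a. a \<in> A \<Longrightarrow> f a \<in> P) \<Longrightarrow> \<phi> (sum f A) = (\<Oplus>\<^bsub>B\<^esub>a\<in>A. \<phi> (f a))"
  by (induction A rule: infinite_finite_induct)
    (simp_all add: phi_zero phi_add phi_closed mpoly_ring_sum Pi_def)

lemma phi_prod: "(\<And>a. a \<in> A \<Longrightarrow> f a \<in> P) \<Longrightarrow> \<phi> (prod f A) = (\<Otimes>\<^bsub>B\<^esub>a\<in>A. \<phi> (f a))"
  by (induction A rule: infinite_finite_induct)
    (simp_all add: phi_one phi_mult phi_closed mpoly_ring_prod Pi_def)

lemma phi_power: "p \<in> P \<Longrightarrow> \<phi> (p ^ e) = \<phi> p [^]\<^bsub>B\<^esub> e"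
  by (induction e) (simp_all add: phi_one phi_mult mpoly_ring_power phi_closed S.m_comm)

definition homogeneous :: "nat \<Rightarrow> 'k mpoly set" where
  "homogeneous j = {p \<in> P. \<forall>t\<in>Poly_Mapping.keys p. mono_weight w t = j}"

lemma homogeneous_subset: "homogeneous j \<subseteq> P"
  by (auto simp: homogeneous_def)

lemma homogeneous_subset_polys_below: "j \<le> i \<Longrightarrow> homogeneous j \<subseteq> polys_below (i + 1)"
  by (auto simp: homogeneous_def polys_below_def)

lemma hcomp_homogeneous: "p \<in> P \<Longrightarrow> hcomp w j p \<in> homogeneous j"
  by (auto simp: homogeneous_def keys_hcomp hcomp_in_mpoly_ring)

lemma homogeneous_zero: "0 \<in> homogeneous j"
  by (simp add: homogeneous_def mpoly_ring_zero)

lemma homogeneous_Const: "Const c \<in> homogeneous 0"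
  by (simp add: homogeneous_def mpoly_ring_Const) (simp add: Const_def mono_weight_def)

lemma homogeneous_one: "1 \<in> homogeneous 0"
  using homogeneous_Const[of 1] by (simp add: Const_def)

lemma homogeneous_Var: "v \<in> V \<Longrightarrow> Var v \<in> homogeneous (w v)"
  by (simp add: homogeneous_def mpoly_ring_Var) (simp add: Var_def mono_weight_def)

lemma homogeneous_add: "p \<in> homogeneous j \<Longrightarrow> q \<in> homogeneous j \<Longrightarrow> p + q \<in> homogeneous j"
  using Poly_Mapping.keys_add[of p q] by (auto simp: homogeneous_def mpoly_ring_add)

lemma homogeneous_uminus: "p \<in> homogeneous j \<Longrightarrow> - p \<in> homogeneous j"
  by (auto simp: homogeneous_def mpoly_ring_uminus)

lemma homogeneous_mult: "p \<in> homogeneous i \<Longrightarrow> q \<in> homogeneous j \<Longrightarrow> p * q \<in> homogeneous (i + j)"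
  using keys_mult[of p q] by (fastforce simp: homogeneous_def mpoly_ring_mult mono_weight_add)

lemma homogeneous_power: "p \<in> homogeneous i \<Longrightarrow> p ^ e \<in> homogeneous (i * e)"
  by (induction e) (auto simp: homogeneous_one homogeneous_mult)

lemma homogeneous_prod:
  "finite A \<Longrightarrow> (\<And>a. a \<in> A \<Longrightarrow> f a \<in> homogeneous (g a)) \<Longrightarrow> prod f A \<in> homogeneous (sum g A)"
  by (induction A rule: finite_induct) (auto simp: homogeneous_one homogeneous_mult)

end

section \<open>Spans over a subring\<close>

lemma (in abelian_monoid) finsum_in_submonoid:
  assumes "M \<subseteq> carrier G" "\<zero> \<in> M" "\<And>a b. a \<in> M \<Longrightarrow> b \<in> M \<Longrightarrow> a \<oplus> b \<in> M"
    and "\<And>a. a \<in> F \<Longrightarrow> f a \<in> M"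
  shows "(\<Oplus>a\<in>F. f a) \<in> M"
  using assms(4)
proof (induction F rule: infinite_finite_induct)
  case (insert a F)
  then have "f \<in> F \<rightarrow> carrier G" "f a \<in> carrier G" using assms(1) by auto
  with insert show ?case by (simp add: assms(3))
qed (simp_all add: assms(2))

context ring
begin

lemma lin_span_zero: "\<zero> \<in> lin_span R A E"
  unfolding lin_span_def by (intro CollectI exI[of _ "{}"]) auto

lemma lin_span_add:
  assumes A: "subring A R" and E: "E \<subseteq> carrier R"
    and "a \<in> lin_span R A E" "b \<in> lin_span R A E"
  shows "a \<oplus> b \<in> lin_span R A E"
proof -
  obtain F c where F: "finite F" "F \<subseteq> E" "c \<in> F \<rightarrow> A" "a = (\<Oplus>g\<in>F. c g \<otimes> g)"
    using assms(3) unfolding lin_span_def by blast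
  obtain F' c' where F': "finite F'" "F' \<subseteq> E" "c' \<in> F' \<rightarrow> A" "b = (\<Oplus>g\<in>F'. c' g \<otimes> g)"
    using assms(4) unfolding lin_span_def by blast
  \<comment> \<open>Extended by zero, the coefficients of both sums are defined on \<open>F \<union> F'\<close>.\<close>
  define e e' where "e g = (if g \<in> F then c g else \<zero>)" and "e' g = (if g \<in> F' then c' g else \<zero>)" for g
  have AR: "A \<subseteq> carrier R" by (rule subringE(1)[OF A])
  have eA: "e g \<in> A" "e' g \<in> A" for g
    using F F' subringE(2)[OF A] by (auto simp: e_def e'_def)
  then have eR: "e g \<in> carrier R" "e' g \<in> carrier R" for g using AR by blast+
  have gR: "g \<in> carrier R" if "g \<in> F \<union> F'" for g using that F F' E by blast
  have cR: "c g \<otimes> g \<in> carrier R" if "g \<in> F" for g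
    using funcset_mem[OF F(3) that] that AR F(2) E by (intro m_closed) blast+
  have cR': "c' g \<otimes> g \<in> carrier R" if "g \<in> F'" for g
    using funcset_mem[OF F'(3) that] that AR F'(2) E by (intro m_closed) blast+
  have a: "a = (\<Oplus>g\<in>F \<union> F'. e g \<otimes> g)"
    unfolding F(4)
  proof (rule add.finprod_mono_neutral_cong_left)
    show "c g \<otimes> g = e g \<otimes> g" if "g \<in> F" for g using that by (simp add: e_def)
  qed (use F(1) F'(1) gR cR in \<open>auto simp: e_def\<close>)
  have b: "b = (\<Oplus>g\<in>F \<union> F'. e' g \<otimes> g)"
    unfolding F'(4)
  proof (rule add.finprod_mono_neutral_cong_left)
    show "c' g \<otimes> g = e' g \<otimes> g" if "g \<in> F'" for g using that by (simp add: e'_def)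
  qed (use F(1) F'(1) gR cR' in \<open>auto simp: e'_def\<close>)
  have "a \<oplus> b = (\<Oplus>g\<in>F \<union> F'. e g \<otimes> g \<oplus> e' g \<otimes> g)"
    unfolding a b by (rule finsum_addf[symmetric]) (use gR eR in auto)
  also have "\<dots> = (\<Oplus>g\<in>F \<union> F'. (e g \<oplus> e' g) \<otimes> g)"
    by (rule finsum_cong') (use gR eR in \<open>auto simp: l_distr\<close>)
  finally have "a \<oplus> b = (\<Oplus>g\<in>F \<union> F'. (e g \<oplus> e' g) \<otimes> g)" .
  moreover have "(\<lambda>g. e g \<oplus> e' g) \<in> F \<union> F' \<rightarrow> A"
    using eA subringE(7)[OF A] by blast
  moreover have "finite (F \<union> F')" "F \<union> F' \<subseteq> E" using F F' by auto
  ultimately show ?thesis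
    unfolding lin_span_def
    by (intro CollectI exI[of _ "F \<union> F'"] exI[of _ "\<lambda>g. e g \<oplus> e' g"] conjI)
qed

lemma lin_span_mult:
  assumes "A \<subseteq> carrier R" "E \<subseteq> carrier R" "c \<in> A" "g \<in> E"
  shows "c \<otimes> g \<in> lin_span R A E"
  unfolding lin_span_def
proof (intro CollectI exI conjI)
  have "c \<otimes> g \<in> carrier R" using assms by blast
  then show "c \<otimes> g = (\<Oplus>h\<in>{g}. c \<otimes> h)" by simp
qed (use assms in auto)

lemma lin_span_carrier:
  assumes "A \<subseteq> carrier R" "E \<subseteq> carrier R"
  shows "lin_span R A E \<subseteq> carrier R"
  unfolding lin_span_def using assms by (auto intro!: finsum_closed m_closed simp: Pi_iff subset_iff)

end

section \<open>The presentation by kernel generators and local slices\<close>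

locale extended_presentation =
  fixes I :: "'k::comm_ring_1 mpoly set" and n r m :: nat
    and x z s :: "nat \<Rightarrow> 'k mpoly set" and zp sp :: "nat \<Rightarrow> 'k mpoly" and d :: "nat \<Rightarrow> nat"
    and R B :: "_"
  defines "R \<equiv> mpoly_ring (XVar ` {1..n})"
    and "B \<equiv> mpoly_ring (XVar ` {1..n}) Quot I"
  assumes I_ideal: "ideal I R"
    and B_domain: "domain B"
    and x: "\<And>i. i \<in> {1..n} \<Longrightarrow> x i = I +>\<^bsub>R\<^esub> Var (XVar i)"
    and zp: "\<And>j. j \<in> {1..r} \<Longrightarrow> zp j \<in> carrier R \<and> z j = I +>\<^bsub>R\<^esub> zp j"
    and sp: "\<And>l. l \<in> {1..m} \<Longrightarrow> sp l \<in> carrier R \<and> s l = I +>\<^bsub>R\<^esub> sp l"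
begin

abbreviation V :: "gen set" where "V \<equiv> all_vars r n m"

abbreviation PR :: "'k mpoly ring" where "PR \<equiv> mpoly_ring V"

text \<open>The representing polynomials do not involve the variables \<open>Z\<close> and \<open>S\<close>, so substituting them maps
  the large polynomial ring to \<open>R\<close> and is the identity on \<open>R\<close>.\<close>

definition representative :: "gen \<Rightarrow> 'k mpoly" where
  "representative v = (case v of ZVar j \<Rightarrow> zp j | XVar i \<Rightarrow> Var (XVar i) | SVar l \<Rightarrow> sp l)"

definition \<phi> :: "'k mpoly \<Rightarrow> 'k mpoly set" where
  "\<phi> p = I +>\<^bsub>R\<^esub> subst representative p"

definition K :: "'k mpoly set set" where
  "K = range (\<lambda>c. I +>\<^bsub>R\<^esub> Const c)"

text \<open>Stands for the kernel of the derivation, of which the \<open>z j\<close> are generators over the constants.\<close>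

definition coeff_ring :: "'k mpoly set set" where
  "coeff_ring = generate_ring B (K \<union> z ` {1..r})"

lemma R_subset: "carrier R \<subseteq> carrier PR"
  unfolding R_def by (rule mpoly_ring_mono) (auto simp: all_vars_def)

lemma subst_closed: "p \<in> carrier PR \<Longrightarrow> subst representative p \<in> carrier R"
proof (induction p rule: mpoly_ring_induct)
  case (Var v)
  then show ?case
    using zp sp by (auto simp: subst_Var_gen representative_def all_vars_def R_def mpoly_ring_Var)
qed (auto simp: subst_Const subst_add subst_mult R_def mpoly_ring_Const mpoly_ring_add mpoly_ring_mult)

lemma subst_id: "p \<in> carrier R \<Longrightarrow> subst representative p = p"
  unfolding R_def
proof (induction p rule: mpoly_ring_induct)
  case (Var v)
  then show ?case by (auto simp: subst_Var_gen representative_def)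
qed (auto simp: subst_Const subst_add subst_mult)

lemma rcos_hom: "ring_hom_cring R B ((+>\<^bsub>R\<^esub>) I)"
  using ideal.rcos_ring_hom_cring[OF I_ideal] cring_mpoly_ring unfolding R_def B_def by blast

lemma phi_hom: "ring_hom_cring PR B \<phi>"
proof -
  interpret r: ring_hom_cring R B "(+>\<^bsub>R\<^esub>) I" by (rule rcos_hom)
  have R_ops: "a \<oplus>\<^bsub>R\<^esub> b = a + b" "a \<otimes>\<^bsub>R\<^esub> b = a * b" "\<one>\<^bsub>R\<^esub> = 1" for a b
    by (simp_all add: R_def)
  show ?thesis
  proof (intro ring_hom_cring.intro ring_hom_cring_axioms.intro cring_mpoly_ring r.S.is_cring ring_hom_memI)
    fix p q assume "p \<in> carrier PR" "q \<in> carrier PR"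
    then have pq: "subst representative p \<in> carrier R" "subst representative q \<in> carrier R" by (simp_all add: subst_closed)
    show "\<phi> p \<in> carrier B" unfolding \<phi>_def by (rule r.hom_closed[OF pq(1)])
    show "\<phi> (p \<otimes>\<^bsub>PR\<^esub> q) = \<phi> p \<otimes>\<^bsub>B\<^esub> \<phi> q" "\<phi> (p \<oplus>\<^bsub>PR\<^esub> q) = \<phi> p \<oplus>\<^bsub>B\<^esub> \<phi> q"
      using r.hom_mult[OF pq] r.hom_add[OF pq] by (simp_all add: \<phi>_def subst_mult subst_add R_ops)
  next
    show "\<phi> \<one>\<^bsub>PR\<^esub> = \<one>\<^bsub>B\<^esub>"
      using r.hom_one subst_Const[of representative 1] by (simp add: \<phi>_def R_ops Const_def)
  qed
qed

lemma carrier_B: "carrier B = (\<lambda>p. I +>\<^bsub>R\<^esub> p) ` carrier R"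
  by (simp only: B_def R_def FactRing_def A_RCOSETS_def' partial_object.simps UNION_singleton_eq_range)

lemma phi_surj: "\<phi> ` carrier PR = carrier B"
proof
  show "\<phi> ` carrier PR \<subseteq> carrier B"
    by (auto simp: \<phi>_def carrier_B intro: subst_closed)
  show "carrier B \<subseteq> \<phi> ` carrier PR"
  proof
    fix b assume "b \<in> carrier B"
    then obtain p where p: "p \<in> carrier R" "b = I +>\<^bsub>R\<^esub> p" by (auto simp: carrier_B)
    then have "b = \<phi> p" by (simp add: \<phi>_def subst_id)
    then show "b \<in> \<phi> ` carrier PR" using p R_subset by blast
  qed
qed

sublocale filtered_presentation V B \<phi> "omega d"
  by (intro filtered_presentation.intro filtered_presentation_axioms.intro phi_hom phi_surj
      domain.one_not_zero[OF B_domain])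

lemma phi_Const: "\<phi> (Const c) = I +>\<^bsub>R\<^esub> Const c"
  by (simp add: \<phi>_def subst_Const)

lemma K_eq: "K = \<phi> ` range Const"
  by (simp add: K_def phi_Const image_image)

lemma phi_Var:
  "j \<in> {1..r} \<Longrightarrow> \<phi> (Var (ZVar j)) = z j" "i \<in> {1..n} \<Longrightarrow> \<phi> (Var (XVar i)) = x i"
  "l \<in> {1..m} \<Longrightarrow> \<phi> (Var (SVar l)) = s l"
  using zp sp x by (simp_all add: \<phi>_def subst_Var_gen representative_def)

lemma phi_eq_zero_iff: "p \<in> carrier PR \<Longrightarrow> \<phi> p = \<zero>\<^bsub>B\<^esub> \<longleftrightarrow> subst representative p \<in> I"
proof -
  assume p: "p \<in> carrier PR"
  interpret ideal I R by (rule I_ideal)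
  have "\<zero>\<^bsub>B\<^esub> = I" by (simp add: B_def FactRing_def)
  then show ?thesis
    using a_coset_join1[of I "subst representative p"] a_coset_join2[of "subst representative p" I] subst_closed[OF p] a_subgroup
    by (auto simp: \<phi>_def)
qed

text \<open>The generators of \<open>J\<close> make each variable congruent to its representative, hence each polynomial
  \<open>p\<close> congruent modulo \<open>J\<close> to the polynomial in \<open>R\<close> obtained by substitution. If \<open>\<phi> p = 0\<close>, the latter
  lies in \<open>I\<close>, which is contained in \<open>J\<close>.\<close>

lemma ideal_J_eq_kernel: "ideal_J I r zp n m sp = {p \<in> carrier PR. \<phi> p = \<zero>\<^bsub>B\<^esub>}"
proof
  let ?J = "ideal_J I r zp n m sp"
  let ?g = "I \<union> {Var (ZVar j) - zp j | j. j \<in> {1..r}} \<union> {Var (SVar l) - sp l | l. l \<in> {1..m}}"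
  have I: "I \<subseteq> carrier R"
    by (rule additive_subgroup.a_subset[OF ideal.axioms(1)[OF I_ideal]])
  have V: "ZVar j \<in> V" if "j \<in> {1..r}" for j using that by (auto simp: all_vars_def)
  have V': "SVar l \<in> V" if "l \<in> {1..m}" for l using that by (auto simp: all_vars_def)
  have g: "?g \<subseteq> carrier PR"
  proof -
    have "Var (ZVar j) - zp j \<in> carrier PR" if "j \<in> {1..r}" for j
      using zp[OF that] R_subset by (intro mpoly_ring_diff mpoly_ring_Var V that) blast
    moreover have "Var (SVar l) - sp l \<in> carrier PR" if "l \<in> {1..m}" for l
      using sp[OF that] R_subset by (intro mpoly_ring_diff mpoly_ring_Var V' that) blast
    ultimately show ?thesis using I R_subset by blast
  qed
  have zero: "0 \<in> I"
    using additive_subgroup.zero_closed[OF ideal.axioms(1)[OF I_ideal]] by (simp add: R_def)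
  have g0: "subst representative p \<in> I" if pg: "p \<in> ?g" for p
  proof -
    consider "p \<in> I" | j where "j \<in> {1..r}" "p = Var (ZVar j) - zp j"
      | l where "l \<in> {1..m}" "p = Var (SVar l) - sp l"
      using pg by blast
    then show ?thesis
    proof cases
      case 1
      then show ?thesis using subst_id[OF subsetD[OF I 1]] by simp
    next
      case 2
      then show ?thesis using zp[OF 2(1)] zero by (simp add: subst_diff subst_Var_gen representative_def subst_id)
    next
      case 3
      then show ?thesis using sp[OF 3(1)] zero by (simp add: subst_diff subst_Var_gen representative_def subst_id)
    qed
  qed
  have kernel: "ideal {p \<in> carrier PR. \<phi> p = \<zero>\<^bsub>B\<^esub>} PR"
    by (rule ring_hom_ring.kernel_is_ideal[OF ring.is_ring_hom_ring, unfolded a_kernel_def'])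
  show "?J \<subseteq> {p \<in> carrier PR. \<phi> p = \<zero>\<^bsub>B\<^esub>}"
    unfolding ideal_J_def
  proof (rule R.genideal_minimal[OF kernel], rule subsetI)
    fix p assume p: "p \<in> ?g"
    have "p \<in> carrier PR" by (rule subsetD[OF g p])
    then show "p \<in> {p \<in> carrier PR. \<phi> p = \<zero>\<^bsub>B\<^esub>}"
      using g0[OF p] by (simp add: phi_eq_zero_iff)
  qed
  interpret J: ideal ?J PR
    unfolding ideal_J_def by (rule R.genideal_ideal[OF g])
  have gJ: "?g \<subseteq> ?J" unfolding ideal_J_def by (rule R.genideal_self[OF g])
  have J_add: "a + b \<in> ?J" if "a \<in> ?J" "b \<in> ?J" for a b using J.a_closed[OF that] by simp
  have J_mult: "a * b \<in> ?J" if "a \<in> carrier PR" "b \<in> ?J" for a b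
    using J.I_l_closed[OF that(2,1)] by simp
  have J_zero: "0 \<in> ?J" using J.zero_closed by simp
  have cong: "p - subst representative p \<in> ?J" if "p \<in> carrier PR" for p
    using that
  proof (induction p rule: mpoly_ring_induct)
    case (Const c)
    then show ?case by (simp add: subst_Const J_zero)
  next
    case (Var v)
    have "Var (ZVar j) - zp j \<in> ?J" if "j \<in> {1..r}" for j
      by (rule subsetD[OF gJ]) (use that in blast)
    moreover have "Var (SVar l) - sp l \<in> ?J" if "l \<in> {1..m}" for l
      by (rule subsetD[OF gJ]) (use that in blast)
    ultimately show ?case
      using Var J_zero unfolding subst_Var_gen representative_def all_vars_def by auto
  next
    case (add p q)
    then show ?case using J_add[OF add(3,4)] by (simp add: subst_add algebra_simps)
  next
    case (mult p q)
    \<comment> \<open>With \<open>p'\<close>, \<open>q'\<close> for the results of substitution: \<open>p q - p' q' = p (q - q') + q' (p - p')\<close>.\<close>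
    have "subst representative q \<in> carrier PR" using mult subst_closed R_subset by blast
    then have "p * (q - subst representative q) + subst representative q * (p - subst representative p) \<in> ?J"
      using mult by (intro J_add J_mult) auto
    then show ?case by (simp add: subst_mult algebra_simps)
  qed
  show "{p \<in> carrier PR. \<phi> p = \<zero>\<^bsub>B\<^esub>} \<subseteq> ?J"
  proof
    fix p assume "p \<in> {p \<in> carrier PR. \<phi> p = \<zero>\<^bsub>B\<^esub>}"
    then have p: "p \<in> carrier PR" "\<phi> p = \<zero>\<^bsub>B\<^esub>" by blast+
    then have "subst representative p \<in> I" by (simp add: phi_eq_zero_iff)
    then have "subst representative p \<in> ?J" using gJ by blast
    then have "p - subst representative p + subst representative p \<in> ?J" by (rule J_add[OF cong[OF p(1)]])
    then show "p \<in> ?J" by simp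
  qed
qed

lemma generators_in_B: "K \<union> z ` {1..r} \<subseteq> carrier B"
proof -
  have "z j \<in> carrier B" if "j \<in> {1..r}" for j
    using zp[OF that] by (simp add: carrier_B)
  moreover have "K \<subseteq> carrier B"
    unfolding K_eq by (auto intro: phi_closed mpoly_ring_Const)
  ultimately show ?thesis by blast
qed

lemma coeff_ring_subring: "subring coeff_ring B"
  unfolding coeff_ring_def by (rule S.generate_ring_is_subring[OF generators_in_B])

lemma coeff_ring_subset_phi_homogeneous: "coeff_ring \<subseteq> \<phi> ` homogeneous 0"
proof -
  let ?H = "\<phi> ` homogeneous 0"
  have P: "p \<in> P" if "p \<in> homogeneous 0" for p
    by (rule subsetD[OF homogeneous_subset that])
  have "h \<in> ?H" if "h \<in> generate_ring B (K \<union> z ` {1..r})" for h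
    using that
  proof induction
    case one
    show ?case unfolding phi_one[symmetric] by (rule imageI[OF homogeneous_one])
  next
    case (incl h)
    have "z j \<in> ?H" if "j \<in> {1..r}" for j
    proof -
      have "Var (ZVar j) \<in> homogeneous 0"
        using homogeneous_Var[of "ZVar j"] that by (simp add: all_vars_def)
      then show ?thesis unfolding phi_Var(1)[OF that, symmetric] by (rule imageI)
    qed
    moreover have "K \<subseteq> ?H"
      unfolding K_eq using homogeneous_Const by (intro image_mono) blast
    ultimately show ?case using incl by blast
  next
    case (a_inv h)
    then obtain p where p: "p \<in> homogeneous 0" "h = \<phi> p" by blast
    show ?case
      unfolding p(2) phi_uminus[OF P[OF p(1)], symmetric] by (rule imageI[OF homogeneous_uminus[OF p(1)]])
  next
    case (eng_add h h')
    then obtain p q where p: "p \<in> homogeneous 0" "h = \<phi> p" and q: "q \<in> homogeneous 0" "h' = \<phi> q"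
      by blast
    show ?case
      unfolding p(2) q(2) phi_add[OF P[OF p(1)] P[OF q(1)], symmetric]
      by (rule imageI[OF homogeneous_add[OF p(1) q(1)]])
  next
    case (eng_mult h h')
    then obtain p q where p: "p \<in> homogeneous 0" "h = \<phi> p" and q: "q \<in> homogeneous 0" "h' = \<phi> q"
      by blast
    show ?case
      unfolding p(2) q(2) phi_mult[OF P[OF p(1)] P[OF q(1)], symmetric]
      using homogeneous_mult[OF p(1) q(1)] by (intro imageI) simp
  qed
  then show ?thesis by (auto simp: coeff_ring_def)
qed

definition sx_monomial :: "(nat \<Rightarrow> nat) \<Rightarrow> (nat \<Rightarrow> nat) \<Rightarrow> 'k mpoly" where
  "sx_monomial u v = (\<Prod>l\<in>{1..m}. Var (SVar l) ^ u l) * (\<Prod>i\<in>{1..n}. Var (XVar i) ^ v i)"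

lemma Vs: "j \<in> {1..r} \<Longrightarrow> ZVar j \<in> V" "i \<in> {1..n} \<Longrightarrow> XVar i \<in> V" "l \<in> {1..m} \<Longrightarrow> SVar l \<in> V"
  by (auto simp: all_vars_def)

lemma sx_monomial_homogeneous:
  "sx_monomial u v \<in> homogeneous ((\<Sum>l\<in>{1..m}. u l) + (\<Sum>i\<in>{1..n}. d i * v i))"
proof -
  have "Var (SVar l) ^ u l \<in> homogeneous (u l)" if "l \<in> {1..m}" for l
    using homogeneous_power[OF homogeneous_Var[OF Vs(3)[OF that]], of "u l"] by simp
  moreover have "Var (XVar i) ^ v i \<in> homogeneous (d i * v i)" if "i \<in> {1..n}" for i
    using homogeneous_power[OF homogeneous_Var[OF Vs(2)[OF that]], of "v i"] by simp
  ultimately show ?thesis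
    unfolding sx_monomial_def by (intro homogeneous_mult homogeneous_prod) auto
qed

lemma phi_sx_monomial:
  "\<phi> (sx_monomial u v) =
    (\<Otimes>\<^bsub>B\<^esub>l\<in>{1..m}. s l [^]\<^bsub>B\<^esub> u l) \<otimes>\<^bsub>B\<^esub> (\<Otimes>\<^bsub>B\<^esub>i\<in>{1..n}. x i [^]\<^bsub>B\<^esub> v i)"
proof -
  have S: "Var (SVar l) \<in> P" "\<phi> (Var (SVar l) ^ u l) = s l [^]\<^bsub>B\<^esub> u l" if "l \<in> {1..m}" for l
    using Vs(3)[OF that] by (auto simp: mpoly_ring_Var phi_power phi_Var(3)[OF that])
  have X: "Var (XVar i) \<in> P" "\<phi> (Var (XVar i) ^ v i) = x i [^]\<^bsub>B\<^esub> v i" if "i \<in> {1..n}" for i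
    using Vs(2)[OF that] by (auto simp: mpoly_ring_Var phi_power phi_Var(2)[OF that])
  have "\<phi> (\<Prod>l\<in>{1..m}. Var (SVar l) ^ u l) = (\<Otimes>\<^bsub>B\<^esub>l\<in>{1..m}. \<phi> (Var (SVar l) ^ u l))"
    by (rule phi_prod) (rule mpoly_ring_power[OF S(1)])
  also have "\<dots> = (\<Otimes>\<^bsub>B\<^esub>l\<in>{1..m}. s l [^]\<^bsub>B\<^esub> u l)"
    by (rule S.finprod_cong') (auto simp flip: S(2) intro!: phi_closed mpoly_ring_power S(1))
  finally have s: "\<phi> (\<Prod>l\<in>{1..m}. Var (SVar l) ^ u l) = (\<Otimes>\<^bsub>B\<^esub>l\<in>{1..m}. s l [^]\<^bsub>B\<^esub> u l)" .
  have "\<phi> (\<Prod>i\<in>{1..n}. Var (XVar i) ^ v i) = (\<Otimes>\<^bsub>B\<^esub>i\<in>{1..n}. \<phi> (Var (XVar i) ^ v i))"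
    by (rule phi_prod) (rule mpoly_ring_power[OF X(1)])
  also have "\<dots> = (\<Otimes>\<^bsub>B\<^esub>i\<in>{1..n}. x i [^]\<^bsub>B\<^esub> v i)"
    by (rule S.finprod_cong') (auto simp flip: X(2) intro!: phi_closed mpoly_ring_power X(1))
  finally have x: "\<phi> (\<Prod>i\<in>{1..n}. Var (XVar i) ^ v i) = (\<Otimes>\<^bsub>B\<^esub>i\<in>{1..n}. x i [^]\<^bsub>B\<^esub> v i)" .
  have "(\<Prod>l\<in>{1..m}. Var (SVar l) ^ u l) \<in> P" "(\<Prod>i\<in>{1..n}. Var (XVar i) ^ v i) \<in> P"
    by (rule mpoly_ring_prod, rule mpoly_ring_power, erule S(1) X(1))+
  then show ?thesis unfolding sx_monomial_def by (simp only: phi_mult s x)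
qed

lemma weighted_monomials_eq:
  "weighted_monomials B m s n x d j =
     {\<phi> (sx_monomial u v) | u v. (\<Sum>l\<in>{1..m}. u l) + (\<Sum>i\<in>{1..n}. d i * v i) = j}"
  by (simp add: weighted_monomials_def phi_sx_monomial)

lemma weighted_monomials_in_B: "weighted_monomials B m s n x d j \<subseteq> carrier B"
  using sx_monomial_homogeneous homogeneous_subset by (auto simp: weighted_monomials_eq intro!: phi_closed)

text \<open>Every monomial splits into a part in the variables \<open>Z\<close>, which is mapped into the coefficient ring
  and does not contribute to the weight, and a part in the variables \<open>S\<close> and \<open>X\<close>.\<close>

lemma monomial_split:
  assumes "Poly_Mapping.keys t \<subseteq> V"
  shows "Poly_Mapping.single t c =
    (Const c * (\<Prod>j\<in>{1..r}. Var (ZVar j) ^ Poly_Mapping.lookup t (ZVar j))) *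
    sx_monomial (\<lambda>l. Poly_Mapping.lookup t (SVar l)) (\<lambda>i. Poly_Mapping.lookup t (XVar i))"
    and "mono_weight (omega d) t =
      (\<Sum>l\<in>{1..m}. Poly_Mapping.lookup t (SVar l)) + (\<Sum>i\<in>{1..n}. d i * Poly_Mapping.lookup t (XVar i))"
proof -
  have inj: "inj_on ZVar C" "inj_on XVar C" "inj_on SVar C" for C by (auto simp: inj_on_def)
  have fin: "finite V" by (simp add: all_vars_def)
  have prod_V: "prod f V = prod (f \<circ> ZVar) {1..r} * (prod (f \<circ> SVar) {1..m} * prod (f \<circ> XVar) {1..n})"
    for f :: "gen \<Rightarrow> 'k mpoly"
  proof -
    have "prod f V = prod f (ZVar ` {1..r}) * prod f (XVar ` {1..n}) * prod f (SVar ` {1..m})"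
      unfolding all_vars_def by (subst prod.union_disjoint; (subst prod.union_disjoint)?; auto)
    then show ?thesis by (simp add: prod.reindex inj mult_ac)
  qed
  have sum_V: "sum f V = sum (f \<circ> ZVar) {1..r} + (sum (f \<circ> SVar) {1..m} + sum (f \<circ> XVar) {1..n})"
    for f :: "gen \<Rightarrow> nat"
  proof -
    have "sum f V = sum f (ZVar ` {1..r}) + sum f (XVar ` {1..n}) + sum f (SVar ` {1..m})"
      unfolding all_vars_def by (subst sum.union_disjoint; (subst sum.union_disjoint)?; auto)
    then show ?thesis by (simp add: sum.reindex inj)
  qed
  have "Poly_Mapping.single t c = Const c * mono_eval Var t"
    by (simp add: mono_eval_Var Const_mult_single)
  then show "Poly_Mapping.single t c =
    (Const c * (\<Prod>j\<in>{1..r}. Var (ZVar j) ^ Poly_Mapping.lookup t (ZVar j))) *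
    sx_monomial (\<lambda>l. Poly_Mapping.lookup t (SVar l)) (\<lambda>i. Poly_Mapping.lookup t (XVar i))"
    by (simp add: mono_eval_superset[OF fin assms] prod_V sx_monomial_def mult.assoc)
  have "mono_weight (omega d) t = (\<Sum>v\<in>V. omega d v * Poly_Mapping.lookup t v)"
    unfolding mono_weight_def
    by (rule sum.mono_neutral_left) (use assms fin in \<open>auto simp: in_keys_iff\<close>)
  then show "mono_weight (omega d) t =
      (\<Sum>l\<in>{1..m}. Poly_Mapping.lookup t (SVar l)) + (\<Sum>i\<in>{1..n}. d i * Poly_Mapping.lookup t (XVar i))"
    by (simp add: sum_V)
qed

lemma piece_H_eq: "piece_H B coeff_ring m s n x d j = \<phi> ` homogeneous j"
proof
  let ?E = "weighted_monomials B m s n x d j"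
  have AB: "coeff_ring \<subseteq> carrier B" by (rule subringE(1)[OF coeff_ring_subring])
  have in_A: "\<phi> (Const c * (\<Prod>j\<in>{1..r}. Var (ZVar j) ^ e j)) \<in> coeff_ring" for c and e :: "nat \<Rightarrow> nat"
  proof -
    have KA: "\<phi> (Const a) \<in> coeff_ring" for a
      unfolding coeff_ring_def by (rule generate_ring.incl) (auto simp: K_eq)
    have mult: "\<phi> (p * q) \<in> coeff_ring" if "p \<in> P" "q \<in> P" "\<phi> p \<in> coeff_ring" "\<phi> q \<in> coeff_ring" for p q
      using that subringE(6)[OF coeff_ring_subring] by (simp add: phi_mult)
    have one: "\<phi> 1 \<in> coeff_ring" using subringE(3)[OF coeff_ring_subring] by (simp add: phi_one)
    have ZA: "\<phi> (Var (ZVar j)) \<in> coeff_ring" if "j \<in> {1..r}" for j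
      unfolding coeff_ring_def by (rule generate_ring.incl) (use that in \<open>simp add: phi_Var\<close>)
    have ZP: "Var (ZVar j) \<in> P" if "j \<in> {1..r}" for j
      by (rule mpoly_ring_Var[OF Vs(1)[OF that]])
    have pow: "\<phi> (p ^ k) \<in> coeff_ring" if "p \<in> P" "\<phi> p \<in> coeff_ring" for p and k :: nat
      by (induction k) (simp_all add: one mult that mpoly_ring_power)
    have "\<phi> (\<Prod>j\<in>F. Var (ZVar j) ^ e j) \<in> coeff_ring" if "finite F" "F \<subseteq> {1..r}" for F
      using that
    proof (induction F)
      case (insert j F)
      then have "j \<in> {1..r}" "\<And>i. i \<in> F \<Longrightarrow> i \<in> {1..r}" by auto
      with insert show ?case
        by (simp add: mult pow ZA ZP mpoly_ring_prod mpoly_ring_power)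
    qed (simp add: one)
    then have "\<phi> (\<Prod>j\<in>{1..r}. Var (ZVar j) ^ e j) \<in> coeff_ring" by blast
    moreover have "(\<Prod>j\<in>{1..r}. Var (ZVar j) ^ e j) \<in> P"
      by (rule mpoly_ring_prod, rule mpoly_ring_power, erule ZP)
    ultimately show ?thesis by (intro mult[OF mpoly_ring_Const _ KA])
  qed
  show "piece_H B coeff_ring m s n x d j \<subseteq> \<phi> ` homogeneous j"
  proof
    fix h assume "h \<in> piece_H B coeff_ring m s n x d j"
    then obtain F c where F: "finite F" "F \<subseteq> ?E" "c \<in> F \<rightarrow> coeff_ring" "h = (\<Oplus>\<^bsub>B\<^esub>g\<in>F. c g \<otimes>\<^bsub>B\<^esub> g)"
      unfolding piece_H_def lin_span_def by blast
    show "h \<in> \<phi> ` homogeneous j"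
      unfolding F(4)
    proof (rule S.finsum_in_submonoid)
      show "\<phi> ` homogeneous j \<subseteq> carrier B" using homogeneous_subset phi_closed by blast
      show "\<zero>\<^bsub>B\<^esub> \<in> \<phi> ` homogeneous j" using homogeneous_zero phi_zero by (metis imageI)
      fix a b assume "a \<in> \<phi> ` homogeneous j" "b \<in> \<phi> ` homogeneous j"
      then show "a \<oplus>\<^bsub>B\<^esub> b \<in> \<phi> ` homogeneous j"
        using homogeneous_subset homogeneous_add by (auto simp: subset_iff simp flip: phi_add)
    next
      fix g assume g: "g \<in> F"
      then obtain p where p: "p \<in> homogeneous 0" "c g = \<phi> p"
        using F(3) coeff_ring_subset_phi_homogeneous by blast
      obtain q where q: "q \<in> homogeneous j" "g = \<phi> q"
        using g F(2) sx_monomial_homogeneous unfolding weighted_monomials_eq by blast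
      have "c g \<otimes>\<^bsub>B\<^esub> g = \<phi> (p * q)"
        using p q homogeneous_subset by (simp add: phi_mult subset_iff)
      then show "c g \<otimes>\<^bsub>B\<^esub> g \<in> \<phi> ` homogeneous j"
        using homogeneous_mult[OF p(1) q(1)] by simp
    qed
  qed
  show "\<phi> ` homogeneous j \<subseteq> piece_H B coeff_ring m s n x d j"
  proof
    fix h assume "h \<in> \<phi> ` homogeneous j"
    then obtain p where p: "p \<in> homogeneous j" "h = \<phi> p" by blast
    let ?f = "\<lambda>t. Poly_Mapping.single t (Poly_Mapping.lookup p t)"
    have t: "Poly_Mapping.keys t \<subseteq> V" "mono_weight (omega d) t = j"
      if "t \<in> Poly_Mapping.keys p" for t
      using p(1) that by (auto simp: homogeneous_def in_mpoly_ring)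
    have "\<phi> p = \<phi> (\<Sum>t\<in>Poly_Mapping.keys p. ?f t)"
      by (rule arg_cong[OF sum_monomials])
    also have "\<dots> = (\<Oplus>\<^bsub>B\<^esub>t\<in>Poly_Mapping.keys p. \<phi> (?f t))"
      by (rule phi_sum) (rule mpoly_ring_single[OF t(1)])
    also have "\<dots> \<in> lin_span B coeff_ring ?E"
    proof (rule S.finsum_in_submonoid)
      show "lin_span B coeff_ring ?E \<subseteq> carrier B"
        by (rule S.lin_span_carrier[OF AB weighted_monomials_in_B])
      show "\<zero>\<^bsub>B\<^esub> \<in> lin_span B coeff_ring ?E" by (rule S.lin_span_zero)
      show "a \<oplus>\<^bsub>B\<^esub> b \<in> lin_span B coeff_ring ?E" if "a \<in> lin_span B coeff_ring ?E" "b \<in> lin_span B coeff_ring ?E" for a b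
        by (rule S.lin_span_add[OF coeff_ring_subring weighted_monomials_in_B that])
      fix t assume tp: "t \<in> Poly_Mapping.keys p"
      let ?c = "Const (Poly_Mapping.lookup p t) *
        (\<Prod>j\<in>{1..r}. Var (ZVar j) ^ Poly_Mapping.lookup t (ZVar j))"
      let ?g = "sx_monomial (\<lambda>l. Poly_Mapping.lookup t (SVar l)) (\<lambda>i. Poly_Mapping.lookup t (XVar i))"
      have "?c \<in> P"
        by (intro mpoly_ring_mult mpoly_ring_Const mpoly_ring_prod mpoly_ring_power mpoly_ring_Var Vs)
      moreover have "?g \<in> P" using sx_monomial_homogeneous homogeneous_subset by blast
      ultimately have "\<phi> (?f t) = \<phi> ?c \<otimes>\<^bsub>B\<^esub> \<phi> ?g"
        by (simp add: monomial_split(1)[OF t(1)[OF tp]] phi_mult)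
      moreover have "\<phi> ?g \<in> ?E"
        unfolding weighted_monomials_eq using t(2)[OF tp] monomial_split(2)[OF t(1)[OF tp]] by auto
      ultimately show "\<phi> (?f t) \<in> lin_span B coeff_ring ?E"
        using S.lin_span_mult[OF AB weighted_monomials_in_B in_A] by simp
    qed
    finally show "h \<in> piece_H B coeff_ring m s n x d j" by (simp add: p piece_H_def)
  qed
qed

lemma filtration_G_eq: "filtration_G B coeff_ring m s n x d = image_filtration"
proof (rule ext, intro equalityI subsetI)
  fix i b
  assume "b \<in> filtration_G B coeff_ring m s n x d i"
  then obtain h where h: "\<And>j. j \<le> i \<Longrightarrow> h j \<in> \<phi> ` homogeneous j" "b = (\<Oplus>\<^bsub>B\<^esub>j\<in>{..i}. h j)"
    unfolding filtration_G_def piece_H_eq by blast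
  show "b \<in> image_filtration i"
    unfolding h(2)
  proof (rule S.finsum_in_submonoid)
    show "image_filtration i \<subseteq> carrier B" unfolding image_filtration_def using polys_below_subset phi_closed by blast
    show "\<zero>\<^bsub>B\<^esub> \<in> image_filtration i" unfolding image_filtration_def using polys_below_mono[of 0 "i + 1"] phi_zero by (force simp: polys_below_0)
    show "a \<oplus>\<^bsub>B\<^esub> b \<in> image_filtration i" if "a \<in> image_filtration i" "b \<in> image_filtration i" for a b
      using that polys_below_subset polys_below_add by (auto simp: image_filtration_def subset_iff simp flip: phi_add)
    show "h j \<in> image_filtration i" if "j \<in> {..i}" for j
      using h(1)[of j] homogeneous_subset_polys_below[of j i] that unfolding image_filtration_def by auto
  qed
next
  fix i b
  assume "b \<in> image_filtration i"
  then obtain p where p: "p \<in> polys_below (i + 1)" "b = \<phi> p" by (auto simp: image_filtration_def)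
  have P: "p \<in> P" using p polys_below_subset by blast
  have "p = (\<Sum>j\<le>i. hcomp (omega d) j p)"
    by (rule sum_hcomp) (use p in \<open>auto simp: polys_below_def\<close>)
  then have "b = \<phi> (\<Sum>j\<le>i. hcomp (omega d) j p)" using p by simp
  also have "\<dots> = (\<Oplus>\<^bsub>B\<^esub>j\<in>{..i}. \<phi> (hcomp (omega d) j p))"
    by (rule phi_sum) (rule hcomp_in_mpoly_ring[OF P])
  finally show "b \<in> filtration_G B coeff_ring m s n x d i"
    unfolding filtration_G_def piece_H_eq using hcomp_homogeneous[OF P] by blast
qed

theorem proper_filtration_G_iff_primeideal:
  "proper_N_filtration K B (filtration_G B coeff_ring m s n x d) \<longleftrightarrow>
     primeideal (top_ideal (omega d) V (ideal_J I r zp n m sp)) PR"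
  unfolding filtration_G_eq K_eq ideal_J_eq_kernel by (rule proper_iff_primeideal)

end

section \<open>Properness of the filtration and primality of the ideal of highest components\<close>

theorem proposition2p5:
  fixes I :: "'k::field_char_0 mpoly set"
    and n r m :: nat
    and D :: "'k mpoly set \<Rightarrow> 'k mpoly set"
    and x z s :: "nat \<Rightarrow> 'k mpoly set"
    and zp sp :: "nat \<Rightarrow> 'k mpoly"
    and d :: "nat \<Rightarrow> nat"
  defines "R \<equiv> mpoly_ring (XVar ` {1..n})"
    and "B \<equiv> mpoly_ring (XVar ` {1..n}) Quot I"
    and "K \<equiv> range (\<lambda>c. I +>\<^bsub>mpoly_ring (XVar ` {1..n})\<^esub> Const c)"
  assumes I_ideal: "ideal I R"
    and B_domain: "domain B"
    and origin: "I \<subseteq> Idl\<^bsub>R\<^esub> (Var ` XVar ` {1..n})"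
    and x_def: "\<And>i. i \<in> {1..n} \<Longrightarrow> x i = I +>\<^bsub>R\<^esub> Var (XVar i)"
    and derivation: "derivation_over K B D"
    and nilpotent: "locally_nilpotent B D"
    and zp: "\<And>j. j \<in> {1..r} \<Longrightarrow> zp j \<in> carrier R \<and> z j = I +>\<^bsub>R\<^esub> zp j"
    and z_origin: "\<And>j. j \<in> {1..r} \<Longrightarrow> eval_origin (zp j) = 0"
    and kernel: "lnd_filtration B D 0 = generate_ring B (K \<union> z ` {1..r})"
    and sp: "\<And>l. l \<in> {1..m} \<Longrightarrow> sp l \<in> carrier R \<and> s l = I +>\<^bsub>R\<^esub> sp l"
    and s_origin: "\<And>l. l \<in> {1..m} \<Longrightarrow> eval_origin (sp l) = 0"
    and s_irreducible: "\<And>l. l \<in> {1..m} \<Longrightarrow> ring_irreducible\<^bsub>B\<^esub> (s l)"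
    and s_deg: "\<And>l. l \<in> {1..m} \<Longrightarrow> lnd_deg B D (s l) = Fin 1"
    and F1: "lnd_filtration B D 1 =
               lin_span B (lnd_filtration B D 0) (s ` {1..m} \<union> {\<one>\<^bsub>B\<^esub>})"
    and plinth: "plinth B D =
               Idl\<^bsub>B\<lparr>carrier := lnd_filtration B D 0\<rparr>\<^esub> ((\<lambda>l. D (s l)) ` {1..m})"
    and d_def: "\<And>i. i \<in> {1..n} \<Longrightarrow> lnd_deg B D (x i) = Fin (d i)"
  shows "proper_N_filtration K B (filtration_G B (lnd_filtration B D 0) m s n x d) \<longleftrightarrow>
         primeideal (top_ideal (omega d) (all_vars r n m) (ideal_J I r zp n m sp))
                    (mpoly_ring (all_vars r n m))"
proof -
  interpret pres: extended_presentation I n r m x z s zp sp d R B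
  proof (unfold extended_presentation_def, intro conjI allI impI)
  qed (use I_ideal B_domain x_def zp sp in \<open>simp_all add: R_def B_def\<close>)
  have "pres.K = K" by (simp add: pres.K_def K_def R_def)
  moreover from this have "pres.coeff_ring = lnd_filtration B D 0"
    by (simp add: pres.coeff_ring_def kernel)
  ultimately show ?thesis
    using pres.proper_filtration_G_iff_primeideal by simp
qed

end
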